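(* Let $G^\omega=\mathrm{Diff}^\omega_+S^1$ and $\tilde G^\omega=\widetilde{\mathrm{Diff}}{}^\omega_+S^1$. Suppose that there exist one element $\sigma\in H_2(BG^{\omega,\delta};\mathbb{Z})$ with $\chi(\sigma)\neq0$ and one integer $k\ge2$ such that $$(\varphi_k)_*(\mu(\sigma))=\mu(\sigma)\in H_3(B\tilde G^{\omega,\delta};\mathbb{Z}).$$ Then $$\chi^2\neq0\in H^4(BG^{\omega,\delta};\mathbb{Q}).$$
   Context: $G^\omega=\mathrm{Diff}^\omega_+S^1$ is the group of orientation preserving real analytic diffeomorphisms of $S^1=\mathbb{R}/\mathbb{Z}$, and $\tilde G^\omega=\{f\in\mathrm{Diff}^\omega_+\mathbb{R}: fT=Tf\}$ with $T(x)=x+1$ is its universal covering group. The superscript $\delta$ means the group is given the discrete topology, so $H_*(BG^{\omega,\delta})$ and $H_*(B\tilde G^{\omega,\delta})$ are the homology of the abstract groups. There is a central extension $0\to\mathbb{Z}\to\tilde G^\omega\overset{p}{\to}G^\omega\to1$ (the kernel is generated by $T$), with Euler class $\chi\in H^2(BG^{\omega,\delta};\mathbb{Z})$; its image in rational cohomology is also denoted $\chi$. Up to homotopy, $B\tilde G^{\omega,\delta}\to BG^{\omega,\delta}$ is the principal $S^1$-bundle with Euler class $\chi$, and $\mu$ is the homomorphism in its homology Gysin exact sequence $$\cdots\to H_{m+2}(BG^{\omega,\delta};\mathbb{Z})\overset{\cap\chi}{\to}H_m(BG^{\omega,\delta};\mathbb{Z})\overset{\mu}{\to}H_{m+1}(B\tilde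 G^{\omega,\delta};\mathbb{Z})\overset{p_*}{\to}H_{m+1}(BG^{\omega,\delta};\mathbb{Z})\to\cdots.$$ For an integer $k\ge2$, $\varphi_k:\tilde G^\omega\to\tilde G^\omega$ is the endomorphism $\varphi_k(f)(x)=\frac1kf(kx)$. *)

theory Defs
  imports
    "HOL-Analysis.Analysis"
    "HOL-Algebra.Free_Abelian_Groups"
    "HOL-Library.Function_Algebras"
begin

section \<open>Homology and cohomology of discrete groups\<close>

text \<open>
  For a group \<open>G\<close> with the discrete topology, the homology and cohomology of \<open>BG\<close> are
  those of the (unnormalised, inhomogeneous) bar complex: \<open>C_n(G)\<close> is the free abelian
  group on the \<open>n\<close>-tuples \<open>[g_1|...|g_n]\<close> of elements of \<open>G\<close>.
\<close>

definition add_group :: "'a::ab_group_add set \<Rightarrow> 'a monoid"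
  where "add_group A = \<lparr>carrier = A, monoid.mult = (+), one = 0\<rparr>"

definition coset_class :: "'a::ab_group_add set \<Rightarrow> 'a \<Rightarrow> 'a set"
  where "coset_class B z = B #>\<^bsub>add_group UNIV\<^esub> z"

text \<open>
  The map between subquotients induced by a map \<open>F\<close> of representatives; \<open>B\<close> is the
  subgroup divided out in the target.
\<close>

definition class_map :: "'b::ab_group_add set \<Rightarrow> ('a \<Rightarrow> 'b) \<Rightarrow> 'a set \<Rightarrow> 'b set"
  where "class_map B F X = the_elem ((\<lambda>z. coset_class B (F z)) ` X)"

definition bar_tuples :: "('a, 'm) monoid_scheme \<Rightarrow> nat \<Rightarrow> 'a list set"
  where "bar_tuples G n = {xs. length xs = n \<and> set xs \<subseteq> carrier G}"

definition bar_face :: "('a, 'm) monoid_scheme \<Rightarrow> nat \<Rightarrow> 'a list \<Rightarrow> 'a list"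
  where "bar_face G i xs =
    (if i = 0 then tl xs
     else if i \<ge> length xs then butlast xs
     else take (i - 1) xs @ (xs ! (i - 1) \<otimes>\<^bsub>G\<^esub> xs ! i) # drop (Suc i) xs)"

definition bar_chains :: "('a, 'm) monoid_scheme \<Rightarrow> nat \<Rightarrow> ('a list \<Rightarrow>\<^sub>0 int) set"
  where "bar_chains G n = carrier (free_Abelian_group (bar_tuples G n))"

definition bar_boundary :: "('a, 'm) monoid_scheme \<Rightarrow> ('a list \<Rightarrow>\<^sub>0 int) \<Rightarrow> ('a list \<Rightarrow>\<^sub>0 int)"
  where "bar_boundary G =
    frag_extend (\<lambda>xs. if xs = [] then 0
      else (\<Sum>i\<le>length xs. frag_cmul ((-1) ^ i) (frag_of (bar_face G i xs))))"

definition bar_cycles :: "('a, 'm) monoid_scheme \<Rightarrow> nat \<Rightarrow> ('a list \<Rightarrow>\<^sub>0 int) set"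
  where "bar_cycles G n = {c \<in> bar_chains G n. bar_boundary G c = 0}"

definition bar_boundaries :: "('a, 'm) monoid_scheme \<Rightarrow> nat \<Rightarrow> ('a list \<Rightarrow>\<^sub>0 int) set"
  where "bar_boundaries G n = bar_boundary G ` bar_chains G (Suc n)"

definition group_homology :: "('a, 'm) monoid_scheme \<Rightarrow> nat \<Rightarrow> ('a list \<Rightarrow>\<^sub>0 int) set monoid"
  where "group_homology G n = add_group (bar_cycles G n) Mod bar_boundaries G n"

definition bar_map :: "('a \<Rightarrow> 'b) \<Rightarrow> ('a list \<Rightarrow>\<^sub>0 int) \<Rightarrow> ('b list \<Rightarrow>\<^sub>0 int)"
  where "bar_map f = frag_extend (\<lambda>xs. frag_of (map f xs))"

definition homology_map ::
    "('b, 'm) monoid_scheme \<Rightarrow> nat \<Rightarrow> ('a \<Rightarrow> 'b) \<Rightarrow> ('a list \<Rightarrow>\<^sub>0 int) set \<Rightarrow> ('b list \<Rightarrow>\<^sub>0 int) set"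
  where "homology_map H n f = class_map (bar_boundaries H n) (bar_map f)"

text \<open>
  Cochains with values in \<open>'r\<close> are normalised to vanish outside the \<open>n\<close>-tuples of
  elements of \<open>G\<close>, so that equal cochains are equal functions.
\<close>

definition bar_cochains :: "('a, 'm) monoid_scheme \<Rightarrow> nat \<Rightarrow> ('a list \<Rightarrow> 'r::comm_ring_1) set"
  where "bar_cochains G n = {u. \<forall>xs. xs \<notin> bar_tuples G n \<longrightarrow> u xs = 0}"

definition bar_coboundary ::
    "('a, 'm) monoid_scheme \<Rightarrow> nat \<Rightarrow> ('a list \<Rightarrow> 'r::comm_ring_1) \<Rightarrow> ('a list \<Rightarrow> 'r)"
  where "bar_coboundary G n u =
    (\<lambda>xs. if xs \<in> bar_tuples G (Suc n)
          then (\<Sum>i\<le>Suc n. (-1) ^ i * u (bar_face G i xs)) else 0)"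

definition bar_cocycles :: "('a, 'm) monoid_scheme \<Rightarrow> nat \<Rightarrow> ('a list \<Rightarrow> 'r::comm_ring_1) set"
  where "bar_cocycles G n = {u \<in> bar_cochains G n. bar_coboundary G n u = 0}"

definition bar_coboundaries :: "('a, 'm) monoid_scheme \<Rightarrow> nat \<Rightarrow> ('a list \<Rightarrow> 'r::comm_ring_1) set"
  where "bar_coboundaries G n =
    (if n = 0 then {0} else bar_coboundary G (n - 1) ` bar_cochains G (n - 1))"

definition group_cohomology ::
    "('a, 'm) monoid_scheme \<Rightarrow> nat \<Rightarrow> ('a list \<Rightarrow> 'r::comm_ring_1) set monoid"
  where "group_cohomology G n = add_group (bar_cocycles G n) Mod bar_coboundaries G n"

definition rational_class ::
    "('a, 'm) monoid_scheme \<Rightarrow> nat \<Rightarrow> ('a list \<Rightarrow> int) set \<Rightarrow> ('a list \<Rightarrow> rat) set"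
  where "rational_class G n = class_map (bar_coboundaries G n) (\<lambda>u xs. of_int (u xs))"

definition cup_cochain ::
    "('a, 'm) monoid_scheme \<Rightarrow> nat \<Rightarrow> nat \<Rightarrow> ('a list \<Rightarrow> 'r) \<Rightarrow> ('a list \<Rightarrow> 'r)
      \<Rightarrow> ('a list \<Rightarrow> 'r::comm_ring_1)"
  where "cup_cochain G p q u v =
    (\<lambda>xs. if xs \<in> bar_tuples G (p + q) then u (take p xs) * v (drop p xs) else 0)"

definition cup_product ::
    "('a, 'm) monoid_scheme \<Rightarrow> nat \<Rightarrow> nat \<Rightarrow> ('a list \<Rightarrow> 'r) set \<Rightarrow> ('a list \<Rightarrow> 'r) set
      \<Rightarrow> ('a list \<Rightarrow> 'r::comm_ring_1) set"
  where "cup_product G p q U V =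
    class_map (bar_coboundaries G (p + q)) (\<lambda>(u, v). cup_cochain G p q u v) (U \<times> V)"

definition eval_cochain :: "('a list \<Rightarrow> int) \<Rightarrow> ('a list \<Rightarrow>\<^sub>0 int) \<Rightarrow> int"
  where "eval_cochain u c = (\<Sum>xs\<in>Poly_Mapping.keys c. Poly_Mapping.lookup c xs * u xs)"

definition eval_class :: "('a list \<Rightarrow> int) set \<Rightarrow> ('a list \<Rightarrow>\<^sub>0 int) set \<Rightarrow> int"
  where "eval_class U X = the_elem ((\<lambda>(u, c). eval_cochain u c) ` (U \<times> X))"

text \<open>
  Cap product with the cochain on the front face, so that
  \<open>\<langle>v, u \<inter> c\<rangle> = \<langle>u \<union> v, c\<rangle>\<close>.
\<close>

definition cap_chain :: "nat \<Rightarrow> ('a list \<Rightarrow> int) \<Rightarrow> ('a list \<Rightarrow>\<^sub>0 int) \<Rightarrow> ('a list \<Rightarrow>\<^sub>0 int)"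
  where "cap_chain p u =
    frag_extend (\<lambda>xs. frag_cmul (u (take p xs)) (frag_of (drop p xs)))"


section \<open>Euler class and Gysin map of a central extension by the integers\<close>

text \<open>
  Throughout, \<open>p : E \<rightarrow> Q\<close> is a surjective homomorphism whose kernel is central and
  infinite cyclic with generator \<open>T\<close>. The classes below do not depend on the
  set-theoretic section of \<open>p\<close> used to represent them.
\<close>

definition ext_section :: "('e, 'm) monoid_scheme \<Rightarrow> ('e \<Rightarrow> 'q) \<Rightarrow> 'q \<Rightarrow> 'e"
  where "ext_section E p = inv_into (carrier E) p"

definition euler_cocycle ::
    "('e, 'm) monoid_scheme \<Rightarrow> ('q, 'n) monoid_scheme \<Rightarrow> ('e \<Rightarrow> 'q) \<Rightarrow> 'e \<Rightarrow> 'q list \<Rightarrow> int"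
  where "euler_cocycle E Q p T =
    (\<lambda>xs. if xs \<in> bar_tuples Q 2
      then (THE n::int. ext_section E p (xs ! 0) \<otimes>\<^bsub>E\<^esub> ext_section E p (xs ! 1)
              = (T [^]\<^bsub>E\<^esub> n) \<otimes>\<^bsub>E\<^esub> ext_section E p (xs ! 0 \<otimes>\<^bsub>Q\<^esub> xs ! 1))
      else 0)"

definition euler_class ::
    "('e, 'm) monoid_scheme \<Rightarrow> ('q, 'n) monoid_scheme \<Rightarrow> ('e \<Rightarrow> 'q) \<Rightarrow> 'e \<Rightarrow> ('q list \<Rightarrow> int) set"
  where "euler_class E Q p T = coset_class (bar_coboundaries Q 2) (euler_cocycle E Q p T)"

definition fibre_cochain ::
    "('e, 'm) monoid_scheme \<Rightarrow> ('e \<Rightarrow> 'q) \<Rightarrow> 'e \<Rightarrow> 'e list \<Rightarrow> int"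
  where "fibre_cochain E p T =
    (\<lambda>xs. if xs \<in> bar_tuples E 1
      then (THE n::int. xs ! 0 = (T [^]\<^bsub>E\<^esub> n) \<otimes>\<^bsub>E\<^esub> ext_section E p (p (xs ! 0)))
      else 0)"

text \<open>
  The Gysin sequence of the circle bundle \<open>BE \<rightarrow> BQ\<close> is the homology sequence of the
  pair (disc bundle, circle bundle) combined with the Thom isomorphism. That pair is
  equivalent to \<open>BQ\<close> relative to \<open>BE\<close>, i.e. to the mapping cylinder of \<open>p\<close>, and its
  homology is that of the algebraic mapping cone of the chain map induced by \<open>p\<close>:
  a relative cycle of degree \<open>n\<close> is a chain \<open>c\<close> of \<open>Q\<close> of degree \<open>n\<close> together with a
  cycle \<open>t\<close> of \<open>E\<close> of degree \<open>n - 1\<close> such that the boundary of \<open>c\<close> is the image of \<open>t\<close>.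
\<close>

definition cone_chains ::
    "('e, 'm) monoid_scheme \<Rightarrow> ('q, 'n) monoid_scheme \<Rightarrow> nat
      \<Rightarrow> (('q list \<Rightarrow>\<^sub>0 int) \<times> ('e list \<Rightarrow>\<^sub>0 int)) set"
  where "cone_chains E Q n = bar_chains Q n \<times> (if n = 0 then {0} else bar_chains E (n - 1))"

definition cone_boundary ::
    "('e, 'm) monoid_scheme \<Rightarrow> ('q, 'n) monoid_scheme \<Rightarrow> ('e \<Rightarrow> 'q)
      \<Rightarrow> ('q list \<Rightarrow>\<^sub>0 int) \<times> ('e list \<Rightarrow>\<^sub>0 int) \<Rightarrow> ('q list \<Rightarrow>\<^sub>0 int) \<times> ('e list \<Rightarrow>\<^sub>0 int)"
  where "cone_boundary E Q p = (\<lambda>(c, t). (bar_boundary Q c - bar_map p t, - bar_boundary E t))"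

definition cone_homology ::
    "('e, 'm) monoid_scheme \<Rightarrow> ('q, 'n) monoid_scheme \<Rightarrow> ('e \<Rightarrow> 'q) \<Rightarrow> nat
      \<Rightarrow> (('q list \<Rightarrow>\<^sub>0 int) \<times> ('e list \<Rightarrow>\<^sub>0 int)) set monoid"
  where "cone_homology E Q p n =
    add_group {z \<in> cone_chains E Q n. cone_boundary E Q p z = 0}
      Mod (cone_boundary E Q p ` cone_chains E Q (Suc n))"

text \<open>The connecting homomorphism \<open>H_{n+1}(BQ, BE) \<rightarrow> H_n(BE)\<close>.\<close>

definition cone_connecting ::
    "('e, 'm) monoid_scheme \<Rightarrow> nat \<Rightarrow> (('q list \<Rightarrow>\<^sub>0 int) \<times> ('e list \<Rightarrow>\<^sub>0 int)) set
      \<Rightarrow> ('e list \<Rightarrow>\<^sub>0 int) set"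
  where "cone_connecting E n = class_map (bar_boundaries E n) snd"

text \<open>
  The fibre cochain \<open>\<eta>\<close> satisfies \<open>\<delta>\<eta> = - p\<^sup>*e\<close> for the Euler cocycle \<open>e\<close>, so
  \<open>(c, t) \<mapsto> e(c) + \<eta>(t)\<close> is a cocycle of the mapping cone. It takes the value 1 on the
  fibre class \<open>([1|1], [T])\<close> and thus represents the Thom class, which restricts to the
  Euler class on \<open>BQ\<close>. The Thom isomorphism \<open>H_{m+2}(BQ, BE) \<rightarrow> H_m(BQ)\<close> is the cap
  product with it; its composite with \<open>H_{m+2}(BQ) \<rightarrow> H_{m+2}(BQ, BE)\<close> is the cap
  product with the Euler class.
\<close>

definition thom_chain ::
    "('e, 'm) monoid_scheme \<Rightarrow> ('q, 'n) monoid_scheme \<Rightarrow> ('e \<Rightarrow> 'q) \<Rightarrow> 'e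
      \<Rightarrow> ('q list \<Rightarrow>\<^sub>0 int) \<times> ('e list \<Rightarrow>\<^sub>0 int) \<Rightarrow> ('q list \<Rightarrow>\<^sub>0 int)"
  where "thom_chain E Q p T = (\<lambda>(c, t).
    cap_chain 2 (euler_cocycle E Q p T) c + bar_map p (cap_chain 1 (fibre_cochain E p T) t))"

definition thom_map ::
    "('e, 'm) monoid_scheme \<Rightarrow> ('q, 'n) monoid_scheme \<Rightarrow> ('e \<Rightarrow> 'q) \<Rightarrow> 'e \<Rightarrow> nat
      \<Rightarrow> (('q list \<Rightarrow>\<^sub>0 int) \<times> ('e list \<Rightarrow>\<^sub>0 int)) set \<Rightarrow> ('q list \<Rightarrow>\<^sub>0 int) set"
  where "thom_map E Q p T m = class_map (bar_boundaries Q m) (thom_chain E Q p T)"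

definition gysin_map ::
    "('e, 'm) monoid_scheme \<Rightarrow> ('q, 'n) monoid_scheme \<Rightarrow> ('e \<Rightarrow> 'q) \<Rightarrow> 'e \<Rightarrow> nat
      \<Rightarrow> ('q list \<Rightarrow>\<^sub>0 int) set \<Rightarrow> ('e list \<Rightarrow>\<^sub>0 int) set"
  where "gysin_map E Q p T m \<sigma> =
    cone_connecting E (m + 1)
      (inv_into (carrier (cone_homology E Q p (m + 2))) (thom_map E Q p T m) \<sigma>)"


section \<open>Real analytic diffeomorphisms of the circle\<close>

definition real_analytic_at :: "(real \<Rightarrow> real) \<Rightarrow> real \<Rightarrow> bool"
  where "real_analytic_at f x \<longleftrightarrow> (\<exists>F. (\<lambda>h. f (x + h)) has_fps_expansion F)"

quotient_type circle = real / "\<lambda>x y::real. x - y \<in> \<int>"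
proof (rule equivpI)
  show "reflp (\<lambda>x y::real. x - y \<in> \<int>)"
    by (auto intro: reflpI)
  show "symp (\<lambda>x y::real. x - y \<in> \<int>)"
    by (rule sympI) (metis Ints_minus minus_diff_eq)
  show "transp (\<lambda>x y::real. x - y \<in> \<int>)"
    by (rule transpI) (metis Ints_add diff_add_cancel add_diff_eq)
qed

definition local_lift :: "(circle \<Rightarrow> circle) \<Rightarrow> (real \<Rightarrow> real) \<Rightarrow> real \<Rightarrow> bool"
  where "local_lift F f x \<longleftrightarrow> (\<forall>\<^sub>F t in nhds x. F (abs_circle t) = abs_circle (f t))"

definition circle_analytic :: "(circle \<Rightarrow> circle) \<Rightarrow> bool"
  where "circle_analytic F \<longleftrightarrow> (\<forall>x. \<exists>f. local_lift F f x \<and> real_analytic_at f x)"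

definition circle_orientation_preserving :: "(circle \<Rightarrow> circle) \<Rightarrow> bool"
  where "circle_orientation_preserving F \<longleftrightarrow>
    (\<forall>x f. local_lift F f x \<and> real_analytic_at f x \<longrightarrow> 0 < deriv f x)"

definition diff_circle :: "(circle \<Rightarrow> circle) monoid"
  where "diff_circle =
    \<lparr>carrier = {F. bij F \<and> circle_analytic F \<and> circle_analytic (inv_into UNIV F)
                  \<and> circle_orientation_preserving F},
     monoid.mult = (\<circ>), one = id\<rparr>"

definition diff_line :: "(real \<Rightarrow> real) set"
  where "diff_line =
    {f. bij f \<and> (\<forall>x. real_analytic_at f x) \<and> (\<forall>x. real_analytic_at (inv_into UNIV f) x)
        \<and> (\<forall>x. 0 < deriv f x)}"

definition unit_translation :: "real \<Rightarrow> real"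
  where "unit_translation x = x + 1"

definition diff_circle_cover :: "(real \<Rightarrow> real) monoid"
  where "diff_circle_cover =
    \<lparr>carrier = {f \<in> diff_line. f \<circ> unit_translation = unit_translation \<circ> f},
     monoid.mult = (\<circ>), one = id\<rparr>"

text \<open>
  For \<open>f\<close> commuting with \<open>unit_translation\<close> this is the induced map on \<open>\<real>/\<int>\<close>,
  independently of the representative.
\<close>

definition cover_proj :: "(real \<Rightarrow> real) \<Rightarrow> (circle \<Rightarrow> circle)"
  where "cover_proj f = (\<lambda>z. abs_circle (f (rep_circle z)))"

definition diff_euler_class :: "((circle \<Rightarrow> circle) list \<Rightarrow> int) set"
  where "diff_euler_class = euler_class diff_circle_cover diff_circle cover_proj unit_translation"

definition diff_gysin_map ::
    "nat \<Rightarrow> ((circle \<Rightarrow> circle) list \<Rightarrow>\<^sub>0 int) set \<Rightarrow> ((real \<Rightarrow> real) list \<Rightarrow>\<^sub>0 int) set"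
  where "diff_gysin_map = gysin_map diff_circle_cover diff_circle cover_proj unit_translation"

definition dilation_endo :: "nat \<Rightarrow> (real \<Rightarrow> real) \<Rightarrow> (real \<Rightarrow> real)"
  where "dilation_endo k f = (\<lambda>x. 1 / real k * f (real k * x))"

end

theory Submission
  imports Defs "HOL-Complex_Analysis.Complex_Analysis"
begin

text \<open>
  Write \<open>e\<close> for the Euler cocycle and \<open>\<eta>\<close> for the fibre cochain, so that \<open>\<delta>\<eta> = - p\<^sup>*e\<close>. If the square
  of the rational Euler class vanished, say \<open>e \<union> e = \<delta>v\<close>, then \<open>\<theta> = \<eta> \<union> p\<^sup>*e + p\<^sup>*v\<close> would be a
  rational 3-cocycle on the covering group with \<open>\<theta>(\<mu>(\<sigma>)) = \<chi>(\<sigma>)\<close>. The endomorphism \<open>\<phi>\<close> sends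
  \<open>T\<close> to a \<open>k\<close>-th root of \<open>T\<close>, so \<open>k \<phi>\<^sup>*\<eta> - \<eta>\<close> is invariant under \<open>T^k\<close>, and hence so is
  \<open>k^2 \<phi>\<^sup>*\<theta> - \<theta>\<close> up to a coboundary. A \<open>T^k\<close>-invariant cocycle is pulled back from a finite
  central extension of the base group; averaging over \<open>\<int>/k\<close> shows that it is rationally pulled back
  from the base group itself, so it vanishes on \<open>\<mu>(\<sigma>)\<close>. Therefore \<open>\<theta>(\<phi>\<^sub>*\<mu>(\<sigma>)) = \<chi>(\<sigma>) / k^2\<close>,
  and invariance of \<open>\<mu>(\<sigma>)\<close> would force \<open>\<chi>(\<sigma>) = 0\<close>.
\<close>

section \<open>Chains and cochains of the bar complex\<close>

text \<open>The factor \<open>k^2\<close> has two sources: \<open>\<phi>\<close> divides \<eta> by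
  \<open>k\<close>, and it divides \<open>p^*e\<close> by \<open>k\<close> because
  \<open>p^*e = - \<delta>\<eta>\<close>. Both hold only up to correction terms; one of these, the
  product of \<eta> with a coboundary, is not invariant and must be traded for a coboundary before
  averaging applies. The period is \<open>T^k\<close> because \<open>\<phi> T\<close> need not lie
  in the kernel of \<open>p\<close>, whereas the image of \<open>T^k\<close> is \<open>T\<close>. A
  representative \<open>t\<close> of \<mu>(\<sigma>) comes with a base chain \<open>c\<close> whose
  boundary is the image of \<open>t\<close>; this is why classes pulled back from the base vanish on
  it. Two obstacles shape the rest. The section of \<open>p\<close> is arbitrary, so the cochains
  are not normalised and degenerate tuples such as \<open>[1|1]\<close> contribute. And the Gysin
  map selects a preimage under the Thom map by \<open>inv_into\<close>, so the circle bundle over a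
  2-cycle has to be written down to show that a preimage exists; any preimage then serves, because
  \<theta> evaluates on \<open>t\<close> through the Thom chain alone. The circle enters only in
  showing that its diffeomorphism groups form a central extension in which \<open>\<phi>\<close>
  gives a \<open>k\<close>-th root of \<open>T\<close>.\<close>

definition diff_closed :: "'a::ab_group_add set \<Rightarrow> bool"
  where "diff_closed B \<longleftrightarrow> 0 \<in> B \<and> (\<forall>x\<in>B. \<forall>y\<in>B. x - y \<in> B)"

lemma diff_closedD:
  assumes "diff_closed B"
  shows "0 \<in> B" "x \<in> B \<Longrightarrow> y \<in> B \<Longrightarrow> x - y \<in> B" "x \<in> B \<Longrightarrow> - x \<in> B"
    "x \<in> B \<Longrightarrow> y \<in> B \<Longrightarrow> x + y \<in> B"
proof -
  show 0: "0 \<in> B" and diff: "x \<in> B \<Longrightarrow> y \<in> B \<Longrightarrow> x - y \<in> B" for x y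
    using assms by (auto simp: diff_closed_def)
  show minus: "x \<in> B \<Longrightarrow> - x \<in> B" for x
    using diff[OF 0, of x] by simp
  show "x \<in> B \<Longrightarrow> y \<in> B \<Longrightarrow> x + y \<in> B"
    using diff[of x "- y"] minus[of y] by simp
qed

lemma diff_closed_image:
  assumes "diff_closed A" "\<And>x y. f (x - y) = f x - f y"
  shows "diff_closed (f ` A)"
proof -
  have "f 0 = 0" using assms(2)[of 0 0] by simp
  then show ?thesis
    unfolding diff_closed_def
    by (auto simp: assms(2)[symmetric] intro!: image_eqI[of 0 f 0] imageI diff_closedD[OF assms(1)])
qed

lemma coset_class_eq: "coset_class B z = (\<lambda>b. b + z) ` B"
  by (auto simp: coset_class_def r_coset_def add_group_def)

lemma coset_class_eq_iff:
  assumes "diff_closed B"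
  shows "coset_class B x = coset_class B y \<longleftrightarrow> x - y \<in> B"
proof
  assume "coset_class B x = coset_class B y"
  moreover have "x \<in> coset_class B x"
    using diff_closedD(1)[OF assms] by (force simp: coset_class_eq)
  ultimately show "x - y \<in> B" by (auto simp: coset_class_eq)
next
  assume d: "x - y \<in> B"
  have "b + x \<in> coset_class B y" if "b \<in> B" for b
    using diff_closedD(4)[OF assms that d] by (auto simp: coset_class_eq image_iff intro!: bexI[of _ "b + (x - y)"])
  moreover have "b + y \<in> coset_class B x" if "b \<in> B" for b
    using diff_closedD(2)[OF assms that d] by (auto simp: coset_class_eq image_iff intro!: bexI[of _ "b - (x - y)"])
  ultimately show "coset_class B x = coset_class B y"
    by (auto simp: coset_class_eq[of B x] coset_class_eq[of B y])
qed

lemma coset_class_0: "coset_class B 0 = B"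
  by (simp add: coset_class_eq)

lemma carrier_add_group_Mod: "carrier (add_group A Mod B) = coset_class B ` A"
  by (auto simp: FactGroup_def RCOSETS_def coset_class_def r_coset_def add_group_def)

lemma one_add_group_Mod: "\<one>\<^bsub>add_group A Mod B\<^esub> = B"
  by (simp add: FactGroup_def)

lemma the_elem_image:
  assumes "x \<in> X" "\<And>y. y \<in> X \<Longrightarrow> f y = c"
  shows "the_elem (f ` X) = c"
proof -
  have "f ` X = {c}" using assms by auto
  then show ?thesis by simp
qed

lemma class_map_coset_class:
  assumes "diff_closed B'" "0 \<in> B" "\<And>b. b \<in> B \<Longrightarrow> F (b + z) - F z \<in> B'"
  shows "class_map B' F (coset_class B z) = coset_class B' (F z)"
  unfolding class_map_def
proof (rule the_elem_image)
  show "z \<in> coset_class B z"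
    using assms(2) by (force simp: coset_class_eq)
  show "coset_class B' (F y) = coset_class B' (F z)" if "y \<in> coset_class B z" for y
    using that assms by (auto simp: coset_class_eq_iff coset_class_eq[of B])
qed

lemma class_map_coset_class_additive:
  assumes "diff_closed B'" "0 \<in> B" "\<And>x y. F (x + y) = F x + F y" "F ` B \<subseteq> B'"
  shows "class_map B' F (coset_class B z) = coset_class B' (F z)"
  using assms by (intro class_map_coset_class) auto

text \<open>Chain identities are checked on basis tuples by this lemma and
  \<open>frag_additive_eq\<close>. Compatibility with differences is the form that
  \<open>frag_induction\<close> consumes; the set \<open>S\<close> confines the check to tuples of
  group elements, where the group laws are available.\<close>

lemma frag_additive_in:
  fixes F :: "('a \<Rightarrow>\<^sub>0 int) \<Rightarrow> 'b::ab_group_add"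
  assumes "Poly_Mapping.keys c \<subseteq> S" "diff_closed B" "\<And>x. x \<in> S \<Longrightarrow> F (frag_of x) \<in> B"
    "\<And>a b. F (a - b) = F a - F b"
  shows "F c \<in> B"
  using assms(1)
proof (induction c rule: frag_induction)
  case zero
  then show ?case using assms(4)[of 0 0] diff_closedD(1)[OF assms(2)] by simp
next
  case (one x)
  then show ?case by (rule assms(3))
next
  case (diff a b)
  then show ?case using diff_closedD(2)[OF assms(2)] by (simp add: assms(4))
qed

lemma frag_additive_eq:
  fixes F H :: "('a \<Rightarrow>\<^sub>0 int) \<Rightarrow> 'b::ab_group_add"
  assumes "Poly_Mapping.keys c \<subseteq> S" "\<And>x. x \<in> S \<Longrightarrow> F (frag_of x) = H (frag_of x)"
    "\<And>a b. F (a - b) = F a - F b" "\<And>a b. H (a - b) = H a - H b"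
  shows "F c = H c"
proof -
  have "F c - H c \<in> {0}"
    by (rule frag_additive_in[OF assms(1), where F = "\<lambda>c. F c - H c"])
      (simp_all add: diff_closed_def assms(2-4))
  then show ?thesis by simp
qed

lemma frag_cmul_minus2: "frag_cmul k (- a) = - frag_cmul k a"
  by (rule poly_mapping_eqI) simp

lemma frag_cmul_diff_distrib2: "frag_cmul k (a - b) = frag_cmul k a - frag_cmul k b"
  by (rule poly_mapping_eqI) (simp add: lookup_minus algebra_simps)

lemmas frag_simps = frag_cmul_distrib frag_cmul_distrib2 frag_cmul_diff_distrib
  frag_cmul_diff_distrib2 frag_cmul_minus2

text \<open>Coefficients in any commutative ring, since the integral Euler cocycle and the rational
  \<theta> are evaluated on the same integral chains; \<open>eval_cochain\<close> is the integral
  case.\<close>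

definition frag_eval :: "('a \<Rightarrow> 'r::comm_ring_1) \<Rightarrow> ('a \<Rightarrow>\<^sub>0 int) \<Rightarrow> 'r"
  where "frag_eval u c = (\<Sum>x\<in>Poly_Mapping.keys c. of_int (Poly_Mapping.lookup c x) * u x)"

lemma frag_eval_superset:
  assumes "finite K" "Poly_Mapping.keys c \<subseteq> K"
  shows "frag_eval u c = (\<Sum>x\<in>K. of_int (Poly_Mapping.lookup c x) * u x)"
  unfolding frag_eval_def using assms by (intro sum.mono_neutral_left) (auto simp: in_keys_iff)

lemma frag_eval_of [simp]: "frag_eval u (frag_of x) = u x"
  by (simp add: frag_eval_def)

lemma frag_eval_0 [simp]: "frag_eval u 0 = 0"
  by (simp add: frag_eval_def)

lemma frag_eval_diff: "frag_eval u (a - b) = frag_eval u a - frag_eval u b"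
proof -
  let ?K = "Poly_Mapping.keys a \<union> Poly_Mapping.keys b"
  have "frag_eval u c = (\<Sum>x\<in>?K. of_int (Poly_Mapping.lookup c x) * u x)" if "c \<in> {a, b, a - b}" for c
    using that keys_diff[of a b] by (intro frag_eval_superset) auto
  then show ?thesis
    by (simp add: lookup_minus algebra_simps sum_subtractf)
qed

lemma frag_eval_minus: "frag_eval u (- a) = - frag_eval u a"
  using frag_eval_diff[of u 0 a] by simp

lemma frag_eval_add: "frag_eval u (a + b) = frag_eval u a + frag_eval u b"
  using frag_eval_diff[of u a "- b"] by (simp add: frag_eval_minus)

lemma frag_eval_cmul: "frag_eval u (frag_cmul n a) = of_int n * frag_eval u a"
proof -
  have "frag_eval u (frag_cmul n a) = (\<Sum>x\<in>Poly_Mapping.keys a. of_int (Poly_Mapping.lookup (frag_cmul n a) x) * u x)"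
    by (intro frag_eval_superset) auto
  then show ?thesis
    by (simp add: frag_eval_def sum_distrib_left algebra_simps)
qed

lemmas frag_eval_simps = frag_eval_diff frag_eval_minus frag_eval_add frag_eval_cmul

lemma frag_eval_cong:
  assumes "Poly_Mapping.keys c \<subseteq> S" "\<And>x. x \<in> S \<Longrightarrow> u x = v x"
  shows "frag_eval u c = frag_eval v c"
  using assms unfolding frag_eval_def by (intro sum.cong) auto

lemma frag_eval_fun_diff: "frag_eval (\<lambda>x. u x - v x) c = frag_eval u c - frag_eval v c"
  by (simp add: frag_eval_def algebra_simps sum_subtractf)

lemma frag_eval_fun_cmul: "frag_eval (\<lambda>x. r * u x) c = r * frag_eval u c"
  by (simp add: frag_eval_def algebra_simps sum_distrib_left)

lemma frag_eval_frag_extend: "frag_eval u (frag_extend f c) = frag_eval (\<lambda>x. frag_eval u (f x)) c"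
  by (rule frag_additive_eq[where S = UNIV]) (auto simp: frag_extend_diff frag_eval_diff)

lemma eval_cochain_eq_frag_eval: "eval_cochain u c = frag_eval u c"
  by (simp add: eval_cochain_def frag_eval_def)

lemma bar_chains_iff: "c \<in> bar_chains G n \<longleftrightarrow> Poly_Mapping.keys c \<subseteq> bar_tuples G n"
  by (simp add: bar_chains_def)

lemma diff_closed_bar_chains: "diff_closed (bar_chains G n)"
  unfolding diff_closed_def bar_chains_iff
proof (intro conjI ballI)
  show "Poly_Mapping.keys (x - y) \<subseteq> bar_tuples G n"
    if "x \<in> bar_chains G n" "y \<in> bar_chains G n" for x y
    using that keys_diff[of x y] unfolding bar_chains_iff by blast
qed simp

lemma frag_of_bar_chains [simp]: "frag_of xs \<in> bar_chains G n \<longleftrightarrow> xs \<in> bar_tuples G n"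
  by (simp add: bar_chains_iff)

lemma frag_cmul_bar_chains: "c \<in> bar_chains G n \<Longrightarrow> frag_cmul k c \<in> bar_chains G n"
  using keys_cmul[of k c] by (auto simp: bar_chains_iff)

lemmas bar_chains_intros = diff_closedD[OF diff_closed_bar_chains] frag_cmul_bar_chains

lemma frag_extend_bar_chains:
  assumes "c \<in> bar_chains G n" "\<And>xs. xs \<in> bar_tuples G n \<Longrightarrow> f xs \<in> bar_chains H m"
  shows "frag_extend f c \<in> bar_chains H m"
  using assms(1)[unfolded bar_chains_iff] diff_closed_bar_chains
  by (rule frag_additive_in) (auto simp: frag_extend_diff assms(2))

lemma bar_boundary_simps:
  "bar_boundary G (a + b) = bar_boundary G a + bar_boundary G b"
  "bar_boundary G (a - b) = bar_boundary G a - bar_boundary G b"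
  "bar_boundary G (- a) = - bar_boundary G a"
  "bar_boundary G (frag_cmul k a) = frag_cmul k (bar_boundary G a)"
  "bar_boundary G 0 = 0"
  by (simp_all add: bar_boundary_def frag_extend_add frag_extend_diff frag_extend_minus frag_extend_cmul)

lemma bar_map_simps:
  "bar_map f (a + b) = bar_map f a + bar_map f b"
  "bar_map f (a - b) = bar_map f a - bar_map f b"
  "bar_map f (- a) = - bar_map f a"
  "bar_map f (frag_cmul k a) = frag_cmul k (bar_map f a)"
  "bar_map f 0 = 0"
  "bar_map f (frag_of xs) = frag_of (map f xs)"
  by (simp_all add: bar_map_def frag_extend_add frag_extend_diff frag_extend_minus frag_extend_cmul)

lemma cap_chain_simps:
  "cap_chain n u (a + b) = cap_chain n u a + cap_chain n u b"
  "cap_chain n u (a - b) = cap_chain n u a - cap_chain n u b"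
  "cap_chain n u (- a) = - cap_chain n u a"
  "cap_chain n u (frag_cmul k a) = frag_cmul k (cap_chain n u a)"
  "cap_chain n u 0 = 0"
  "cap_chain n u (frag_of xs) = frag_cmul (u (take n xs)) (frag_of (drop n xs))"
  by (simp_all add: cap_chain_def frag_extend_add frag_extend_diff frag_extend_minus frag_extend_cmul)

lemma bar_boundary_2:
  "bar_boundary G (frag_of [a, b]) = frag_of [b] - frag_of [a \<otimes>\<^bsub>G\<^esub> b] + frag_of [a]"
  by (simp add: bar_boundary_def bar_face_def atMost_Suc eval_nat_numeral)

lemma bar_boundary_3:
  "bar_boundary G (frag_of [a, b, c]) =
    frag_of [b, c] - frag_of [a \<otimes>\<^bsub>G\<^esub> b, c] + frag_of [a, b \<otimes>\<^bsub>G\<^esub> c] - frag_of [a, b]"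
  by (simp add: bar_boundary_def bar_face_def atMost_Suc eval_nat_numeral)

lemma bar_boundary_4:
  "bar_boundary G (frag_of [a, b, c, d]) =
    frag_of [b, c, d] - frag_of [a \<otimes>\<^bsub>G\<^esub> b, c, d] + frag_of [a, b \<otimes>\<^bsub>G\<^esub> c, d]
    - frag_of [a, b, c \<otimes>\<^bsub>G\<^esub> d] + frag_of [a, b, c]"
  by (simp add: bar_boundary_def bar_face_def atMost_Suc eval_nat_numeral)

lemma bar_boundary_5:
  "bar_boundary G (frag_of [a, b, c, d, e]) =
    frag_of [b, c, d, e] - frag_of [a \<otimes>\<^bsub>G\<^esub> b, c, d, e] + frag_of [a, b \<otimes>\<^bsub>G\<^esub> c, d, e]
    - frag_of [a, b, c \<otimes>\<^bsub>G\<^esub> d, e] + frag_of [a, b, c, d \<otimes>\<^bsub>G\<^esub> e] - frag_of [a, b, c, d]"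
  by (simp add: bar_boundary_def bar_face_def atMost_Suc eval_nat_numeral)

lemma bar_tuples_2: "xs \<in> bar_tuples G 2 \<longleftrightarrow> (\<exists>a\<in>carrier G. \<exists>b\<in>carrier G. xs = [a, b])"
  by (auto simp: bar_tuples_def length_Suc_conv eval_nat_numeral)

lemma bar_tuples_3:
  "xs \<in> bar_tuples G 3 \<longleftrightarrow> (\<exists>a\<in>carrier G. \<exists>b\<in>carrier G. \<exists>c\<in>carrier G. xs = [a, b, c])"
  by (auto simp: bar_tuples_def length_Suc_conv eval_nat_numeral)

lemma bar_tuples_4:
  "xs \<in> bar_tuples G 4 \<longleftrightarrow>
    (\<exists>a\<in>carrier G. \<exists>b\<in>carrier G. \<exists>c\<in>carrier G. \<exists>d\<in>carrier G. xs = [a, b, c, d])"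
  by (auto simp: bar_tuples_def length_Suc_conv eval_nat_numeral)

lemma bar_tuples_5:
  "xs \<in> bar_tuples G 5 \<longleftrightarrow>
    (\<exists>a\<in>carrier G. \<exists>b\<in>carrier G. \<exists>c\<in>carrier G. \<exists>d\<in>carrier G. \<exists>e\<in>carrier G. xs = [a, b, c, d, e])"
  by (auto simp: bar_tuples_def length_Suc_conv eval_nat_numeral)

lemma bar_tuples_list:
  "[a] \<in> bar_tuples G 1 \<longleftrightarrow> a \<in> carrier G"
  "[a, b] \<in> bar_tuples G 2 \<longleftrightarrow> a \<in> carrier G \<and> b \<in> carrier G"
  "[a, b, c] \<in> bar_tuples G 3 \<longleftrightarrow> a \<in> carrier G \<and> b \<in> carrier G \<and> c \<in> carrier G"
  "[a, b, c, d] \<in> bar_tuples G 4 \<longleftrightarrow>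
    a \<in> carrier G \<and> b \<in> carrier G \<and> c \<in> carrier G \<and> d \<in> carrier G"
  by (auto simp: bar_tuples_def)

lemma bar_face_tuple:
  assumes "monoid G" "xs \<in> bar_tuples G (Suc n)" "i \<le> Suc n"
  shows "bar_face G i xs \<in> bar_tuples G n"
proof -
  interpret monoid G by fact
  have xs: "length xs = Suc n" "set xs \<subseteq> carrier G"
    using assms(2) by (auto simp: bar_tuples_def)
  have nth: "xs ! j \<in> carrier G" if "j \<le> n" for j
    using xs that by (auto simp: subset_iff)
  consider "i = 0" | "i = Suc n" | "0 < i" "i \<le> n" using assms(3) by linarith
  then show ?thesis
  proof cases
    case 1
    then show ?thesis
      using xs by (cases xs) (auto simp: bar_face_def bar_tuples_def)
  next
    case 2
    then show ?thesis
      using xs by (auto simp: bar_face_def bar_tuples_def dest: in_set_butlastD)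
  next
    case 3
    then show ?thesis
      using xs nth[of i] nth[of "i - 1"]
      by (auto simp: bar_face_def bar_tuples_def dest: in_set_takeD in_set_dropD)
  qed
qed

lemma bar_boundary_chains:
  assumes "monoid G" "c \<in> bar_chains G (Suc n)"
  shows "bar_boundary G c \<in> bar_chains G n"
  unfolding bar_boundary_def using assms(2)
proof (rule frag_extend_bar_chains)
  fix xs assume xs: "xs \<in> bar_tuples G (Suc n)"
  then have len: "length xs = Suc n" by (simp add: bar_tuples_def)
  have "(\<Sum>i\<in>I. frag_cmul ((- 1) ^ i) (frag_of (bar_face G i xs))) \<in> bar_chains G n"
    if "finite I" "I \<subseteq> {..Suc n}" for I
    using that by (induction I rule: finite_induct)
      (auto intro!: bar_chains_intros simp: bar_face_tuple[OF assms(1) xs])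
  from this[of "{..Suc n}"]
  show "(if xs = [] then 0 else \<Sum>i\<le>length xs. frag_cmul ((- 1) ^ i) (frag_of (bar_face G i xs)))
    \<in> bar_chains G n"
    using len by auto
qed

lemma bar_map_chains:
  assumes "f \<in> carrier G \<rightarrow> carrier H" "c \<in> bar_chains G n"
  shows "bar_map f c \<in> bar_chains H n"
  unfolding bar_map_def using assms(2)
  by (rule frag_extend_bar_chains) (use assms(1) in \<open>auto simp: bar_tuples_def\<close>)

lemma map_bar_face:
  assumes "f \<in> hom G H" "set xs \<subseteq> carrier G"
  shows "map f (bar_face G i xs) = bar_face H i (map f xs)"
proof -
  have "f (xs ! (i - 1) \<otimes>\<^bsub>G\<^esub> xs ! i) = f (xs ! (i - 1)) \<otimes>\<^bsub>H\<^esub> f (xs ! i)"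
    if "i < length xs"
    using that assms by (intro hom_mult[OF assms(1)]) auto
  then show ?thesis
    by (auto simp: bar_face_def map_tl map_butlast take_map drop_map)
qed

lemma bar_map_boundary:
  assumes "f \<in> hom G H" "c \<in> bar_chains G n"
  shows "bar_map f (bar_boundary G c) = bar_boundary H (bar_map f c)"
  using assms(2)[unfolded bar_chains_iff]
proof (rule frag_additive_eq)
  fix xs assume "xs \<in> bar_tuples G n"
  then have xs: "set xs \<subseteq> carrier G" by (auto simp: bar_tuples_def)
  have "bar_map f (\<Sum>i\<in>I. g i) = (\<Sum>i\<in>I. bar_map f (g i))" if "finite I" for g and I :: "nat set"
    using that by (induction I rule: finite_induct) (auto simp: bar_map_simps)
  then show "bar_map f (bar_boundary G (frag_of xs)) = bar_boundary H (bar_map f (frag_of xs))"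
    by (simp add: bar_boundary_def bar_map_simps map_bar_face[OF assms(1) xs])
qed (auto simp: bar_map_simps bar_boundary_simps)

lemma frag_eval_bar_map: "frag_eval u (bar_map f c) = frag_eval (\<lambda>xs. u (map f xs)) c"
  by (simp add: bar_map_def frag_eval_frag_extend)

lemma frag_eval_cap_chain:
  "frag_eval v (cap_chain n u c) = frag_eval (\<lambda>xs. of_int (u (take n xs)) * v (drop n xs)) c"
  by (simp add: cap_chain_def frag_eval_frag_extend frag_eval_cmul)

lemma frag_eval_boundary:
  "frag_eval u (bar_boundary G c) = frag_eval (\<lambda>xs. frag_eval u (bar_boundary G (frag_of xs))) c"
  by (rule frag_additive_eq[where S = UNIV]) (auto simp: bar_boundary_simps frag_eval_diff)

lemma diff_closed_bar_boundaries: "diff_closed (bar_boundaries G n)"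
  unfolding bar_boundaries_def
  by (intro diff_closed_image diff_closed_bar_chains) (simp add: bar_boundary_simps)

lemma bar_coboundary_linear:
  "bar_coboundary G n (\<lambda>xs. u xs - v xs) = (\<lambda>xs. bar_coboundary G n u xs - bar_coboundary G n v xs)"
  by (auto simp: bar_coboundary_def fun_eq_iff algebra_simps sum_subtractf)

lemma diff_closed_bar_coboundaries: "diff_closed (bar_coboundaries G n)"
proof (cases "n = 0")
  case False
  have "diff_closed (bar_cochains G m :: ('a list \<Rightarrow> 'b::comm_ring_1) set)" for m
    by (auto simp: diff_closed_def bar_cochains_def)
  then show ?thesis
    using False by (auto simp: bar_coboundaries_def fun_diff_def bar_coboundary_linear intro!: diff_closed_image)
qed (simp add: bar_coboundaries_def diff_closed_def)

lemma frag_eval_fun_add: "frag_eval (u + v) c = frag_eval u c + frag_eval v c"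
  by (simp add: frag_eval_def algebra_simps sum.distrib)

text \<open>The degree of \<open>c\<close> matters: \<open>bar_coboundary\<close> is cut off to 0
  outside tuples of length \<open>Suc n\<close>, while the right-hand side has no cut-off.\<close>

lemma frag_eval_coboundary:
  assumes "c \<in> bar_chains G (Suc n)"
  shows "frag_eval (bar_coboundary G n u) c = frag_eval u (bar_boundary G c)"
  unfolding frag_eval_boundary[of u G c]
proof (rule frag_eval_cong)
  fix xs assume xs: "xs \<in> bar_tuples G (Suc n)"
  have "frag_eval u (\<Sum>i\<in>I. g i) = (\<Sum>i\<in>I. frag_eval u (g i))" if "finite I" for g and I :: "nat set"
    using that by (induction I rule: finite_induct) (auto simp: frag_eval_add)
  moreover have "length xs = Suc n" "xs \<noteq> []" using xs by (auto simp: bar_tuples_def)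
  ultimately show "bar_coboundary G n u xs = frag_eval u (bar_boundary G (frag_of xs))"
    using xs by (simp add: bar_coboundary_def bar_boundary_def frag_eval_cmul del: sum.atMost_Suc)
qed (use assms in \<open>simp add: bar_chains_iff\<close>)

lemma bar_coboundary_1:
  assumes "a \<in> carrier G" "b \<in> carrier G"
  shows "bar_coboundary G 1 u [a, b] = u [b] - u [a \<otimes>\<^bsub>G\<^esub> b] + u [a]"
  using frag_eval_coboundary[of "frag_of [a, b]" G 1 u] assms
  by (simp add: bar_boundary_2 frag_eval_simps bar_tuples_def)

lemma bar_coboundary_3:
  assumes "a \<in> carrier G" "b \<in> carrier G" "c \<in> carrier G" "d \<in> carrier G"
  shows "bar_coboundary G 3 u [a, b, c, d] = u [b, c, d] - u [a \<otimes>\<^bsub>G\<^esub> b, c, d]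
    + u [a, b \<otimes>\<^bsub>G\<^esub> c, d] - u [a, b, c \<otimes>\<^bsub>G\<^esub> d] + u [a, b, c]"
  using frag_eval_coboundary[of "frag_of [a, b, c, d]" G 3 u] assms
  by (simp add: bar_boundary_4 frag_eval_simps bar_tuples_def)

lemma bar_coboundaries_numeral:
  "bar_coboundaries G 2 = bar_coboundary G 1 ` bar_cochains G 1"
  "bar_coboundaries G 4 = bar_coboundary G 3 ` bar_cochains G 3"
  by (simp_all add: bar_coboundaries_def)

lemma bar_boundaries_numeral:
  "bar_boundaries G 2 = bar_boundary G ` bar_chains G 3"
  "bar_boundaries G 3 = bar_boundary G ` bar_chains G 4"
  by (simp_all add: bar_boundaries_def eval_nat_numeral)

text \<open>\<open>\<delta>\<delta> = 0\<close> starting from a 1-cochain. It lets a shifted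
  representative of the Euler class be treated as a cocycle in
  \<open>cup_euler_class\<close>.\<close>

lemma bar_coboundaries_2_cocycle:
  fixes b :: "'q list \<Rightarrow> 'r::comm_ring_1"
  assumes "monoid Q" "b \<in> bar_coboundaries Q 2" "a1 \<in> carrier Q" "a2 \<in> carrier Q" "a3 \<in> carrier Q"
  shows "b [a2, a3] - b [a1 \<otimes>\<^bsub>Q\<^esub> a2, a3] + b [a1, a2 \<otimes>\<^bsub>Q\<^esub> a3] - b [a1, a2] = 0"
proof -
  interpret monoid Q by fact
  obtain \<beta> where "b = bar_coboundary Q 1 \<beta>"
    using assms(2) by (auto simp: bar_coboundaries_numeral)
  then show ?thesis
    using assms by (simp add: bar_coboundary_1 m_assoc del: One_nat_def)
qed

section \<open>Central extensions by the integers\<close>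

locale central_Z_extension =
  fixes E :: "('e, 'm) monoid_scheme" and Q :: "('q, 'n) monoid_scheme"
    and p :: "'e \<Rightarrow> 'q" and T :: 'e
  assumes group_E: "group E" and group_Q: "group Q"
    and p_hom: "p \<in> hom E Q" and p_surj: "p ` carrier E = carrier Q"
    and T_mem: "T \<in> carrier E" and p_T: "p T = \<one>\<^bsub>Q\<^esub>"
    and T_central: "x \<in> carrier E \<Longrightarrow> T \<otimes>\<^bsub>E\<^esub> x = x \<otimes>\<^bsub>E\<^esub> T"
    and kernel: "x \<in> carrier E \<Longrightarrow> p x = \<one>\<^bsub>Q\<^esub> \<Longrightarrow> \<exists>n::int. x = T [^]\<^bsub>E\<^esub> n"
    and T_infinite_order: "T [^]\<^bsub>E\<^esub> (m::int) = T [^]\<^bsub>E\<^esub> (n::int) \<Longrightarrow> m = n"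
begin

sublocale E: group E by (rule group_E)
sublocale Q: group Q by (rule group_Q)

abbreviation mult_E (infixl "\<cdot>" 70) where "x \<cdot> y \<equiv> x \<otimes>\<^bsub>E\<^esub> y"
abbreviation mult_Q (infixl "\<star>" 70) where "x \<star> y \<equiv> x \<otimes>\<^bsub>Q\<^esub> y"
abbreviation tp :: "int \<Rightarrow> 'e" where "tp n \<equiv> T [^]\<^bsub>E\<^esub> n"
abbreviation s where "s \<equiv> ext_section E p"
abbreviation e where "e a b \<equiv> euler_cocycle E Q p T [a, b]"
abbreviation \<eta> where "\<eta> x \<equiv> fibre_cochain E p T [x]"

lemma p_mem [simp]: "x \<in> carrier E \<Longrightarrow> p x \<in> carrier Q"
  using p_hom by (auto simp: hom_def)

lemma p_mult [simp]: "x \<in> carrier E \<Longrightarrow> y \<in> carrier E \<Longrightarrow> p (x \<cdot> y) = p x \<star> p y"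
  using p_hom by (rule hom_mult)

lemma p_one [simp]: "p \<one>\<^bsub>E\<^esub> = \<one>\<^bsub>Q\<^esub>"
  using p_hom group_E group_Q by (rule hom_one)

lemma tp_mem [simp]: "tp n \<in> carrier E"
  using T_mem by simp

lemma tp_add: "tp (m + n) = tp m \<cdot> tp n"
  using T_mem by (rule E.int_pow_mult)

lemma tp_0 [simp]: "tp 0 = \<one>\<^bsub>E\<^esub>" and tp_1 [simp]: "tp 1 = T"
  using T_mem by simp_all

lemma tp_central: "x \<in> carrier E \<Longrightarrow> tp n \<cdot> x = x \<cdot> tp n"
proof -
  assume x: "x \<in> carrier E"
  have pos: "tp (int m) \<cdot> x = x \<cdot> tp (int m)" for m
  proof (induction m)
    case (Suc m)
    have "tp (int (Suc m)) \<cdot> x = tp (int m) \<cdot> (T \<cdot> x)"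
      using x T_mem by (simp only: of_nat_Suc add.commute[of 1] tp_add tp_1 E.m_assoc tp_mem)
    also have "\<dots> = (tp (int m) \<cdot> x) \<cdot> T"
      using x T_mem by (simp add: T_central E.m_assoc)
    also have "\<dots> = x \<cdot> tp (int (Suc m))"
      using x T_mem by (simp only: Suc of_nat_Suc add.commute[of 1] tp_add tp_1 E.m_assoc tp_mem)
    finally show ?case .
  qed (use x in simp)
  show "tp n \<cdot> x = x \<cdot> tp n"
  proof (cases "n \<ge> 0")
    case True
    then show ?thesis using pos[of "nat n"] by simp
  next
    case False
    then obtain m where m: "n = - int m" by (metis linear nonpos_int_cases)
    have "inv\<^bsub>E\<^esub> (tp (int m)) \<cdot> x = x \<cdot> inv\<^bsub>E\<^esub> (tp (int m))"
      using pos[of m] x by (metis E.inv_closed E.inv_solve_left E.inv_solve_right' E.m_assoc E.m_closed tp_mem)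
    then show ?thesis
      using T_mem by (simp add: m E.int_pow_neg)
  qed
qed

lemma p_tp [simp]: "p (tp n) = \<one>\<^bsub>Q\<^esub>"
proof -
  show ?thesis using hom_int_pow[OF p_hom T_mem group_E group_Q] p_T by simp
qed

lemma s_mem [simp]: "a \<in> carrier Q \<Longrightarrow> s a \<in> carrier E"
  and p_s [simp]: "a \<in> carrier Q \<Longrightarrow> p (s a) = a"
  unfolding ext_section_def by (metis inv_into_into p_surj) (metis f_inv_into_f p_surj)

lemma fibre_unique:
  assumes "x \<in> carrier E" "tp m \<cdot> x = tp n \<cdot> x"
  shows "m = n"
  using assms T_infinite_order[of m n] by simp

lemma fibre_ex:
  assumes "x \<in> carrier E" "y \<in> carrier E" "p x = p y"
  obtains n where "x = tp n \<cdot> y"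
proof -
  have "p y \<star> p (inv\<^bsub>E\<^esub> y) = \<one>\<^bsub>Q\<^esub>"
    using assms by (simp flip: p_mult)
  then have "p (x \<cdot> inv\<^bsub>E\<^esub> y) = \<one>\<^bsub>Q\<^esub>"
    using assms by simp
  then obtain n where "x \<cdot> inv\<^bsub>E\<^esub> y = tp n"
    using kernel assms by (metis E.inv_closed E.m_closed)
  then have "x = tp n \<cdot> y"
    using assms by (metis E.inv_closed E.inv_solve_right E.inv_inv tp_mem)
  then show thesis by (rule that)
qed

lemma eta_unique:
  assumes "x \<in> carrier E" "x = tp n \<cdot> s (p x)"
  shows "\<eta> x = n"
proof -
  have "\<eta> x = (THE n. x = tp n \<cdot> s (p x))"
    using assms(1) by (simp add: fibre_cochain_def bar_tuples_def)
  also have "\<dots> = n"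
    using assms by (intro the_equality) (metis fibre_unique p_mem s_mem)+
  finally show ?thesis .
qed

lemma eta_eq:
  assumes "x \<in> carrier E"
  shows "tp (\<eta> x) \<cdot> s (p x) = x"
  using assms by (metis eta_unique fibre_ex p_mem p_s s_mem)

lemma euler_eq:
  assumes "a \<in> carrier Q" "b \<in> carrier Q"
  shows "s a \<cdot> s b = tp (e a b) \<cdot> s (a \<star> b)"
proof -
  obtain n where n: "s a \<cdot> s b = tp n \<cdot> s (a \<star> b)"
    by (rule fibre_ex[of "s a \<cdot> s b" "s (a \<star> b)"]) (use assms in auto)
  have "e a b = (THE n. s a \<cdot> s b = tp n \<cdot> s (a \<star> b))"
    using assms by (simp add: euler_cocycle_def bar_tuples_def)
  also have "\<dots> = n"
    using n assms by (intro the_equality) (metis fibre_unique Q.m_closed s_mem)+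
  finally show ?thesis using n by simp
qed

lemma eta_s [simp]: "a \<in> carrier Q \<Longrightarrow> \<eta> (s a) = 0"
  by (rule eta_unique) auto

lemma eta_tp_mult:
  assumes "x \<in> carrier E"
  shows "\<eta> (tp n \<cdot> x) = n + \<eta> x"
proof (rule eta_unique)
  have "tp (n + \<eta> x) \<cdot> s (p x) = tp n \<cdot> x"
    using assms by (simp add: tp_add E.m_assoc eta_eq)
  then show "tp n \<cdot> x = tp (n + \<eta> x) \<cdot> s (p (tp n \<cdot> x))"
    using assms by simp
qed (use assms in simp)

text \<open>The relation \<open>\<delta>\<eta> = - p^*e\<close>: write both factors as a power of
  \<open>T\<close> times a value of \<open>s\<close> and collect the central powers on the
  left.\<close>

lemma eta_mult:
  assumes "x \<in> carrier E" "y \<in> carrier E"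
  shows "\<eta> (x \<cdot> y) = \<eta> x + \<eta> y + e (p x) (p y)"
proof -
  have "x \<cdot> y = (tp (\<eta> x) \<cdot> s (p x)) \<cdot> (tp (\<eta> y) \<cdot> s (p y))"
    using assms by (simp add: eta_eq)
  also have "\<dots> = tp (\<eta> x) \<cdot> ((s (p x) \<cdot> tp (\<eta> y)) \<cdot> s (p y))"
    using assms by (simp add: E.m_assoc)
  also have "\<dots> = tp (\<eta> x) \<cdot> (tp (\<eta> y) \<cdot> (s (p x) \<cdot> s (p y)))"
    using assms by (simp add: E.m_assoc flip: tp_central)
  also have "\<dots> = tp (\<eta> x) \<cdot> (tp (\<eta> y) \<cdot> (tp (e (p x) (p y)) \<cdot> s (p x \<star> p y)))"
    using assms by (simp add: euler_eq)
  finally show ?thesis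
    using assms by (simp add: eta_tp_mult)
qed

text \<open>Associativity in \<open>E\<close>: \<eta> is evaluated on the two bracketings of
  \<open>s a \<cdot> s b \<cdot> s c\<close>.\<close>

lemma euler_cocycle_eq:
  assumes "a \<in> carrier Q" "b \<in> carrier Q" "c \<in> carrier Q"
  shows "e b c + e a (b \<star> c) = e (a \<star> b) c + e a b"
proof -
  have "\<eta> ((s a \<cdot> s b) \<cdot> s c) = e a b + e (a \<star> b) c"
    using assms by (simp add: eta_mult)
  moreover have "\<eta> (s a \<cdot> (s b \<cdot> s c)) = e b c + e a (b \<star> c)"
    using assms by (simp add: eta_mult)
  ultimately show ?thesis
    using assms by (simp add: E.m_assoc)
qed

text \<open>The section may send the identity to any element of the kernel, so \<eta> need not
  vanish at the identity and the value at \<open>T\<close> need not be 1. This constant is carried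
  through \<open>thom_surj\<close>.\<close>

lemma eta_T: "\<eta> T = 1 + \<eta> \<one>\<^bsub>E\<^esub>"
  using eta_tp_mult[of "\<one>\<^bsub>E\<^esub>" 1] T_mem by simp

lemma eta_one: "\<eta> \<one>\<^bsub>E\<^esub> = - e \<one>\<^bsub>Q\<^esub> \<one>\<^bsub>Q\<^esub>"
  using eta_mult[of "\<one>\<^bsub>E\<^esub>" "\<one>\<^bsub>E\<^esub>"] by simp

lemma e_one:
  assumes "a \<in> carrier Q"
  shows "e \<one>\<^bsub>Q\<^esub> a = e \<one>\<^bsub>Q\<^esub> \<one>\<^bsub>Q\<^esub>" "e a \<one>\<^bsub>Q\<^esub> = e \<one>\<^bsub>Q\<^esub> \<one>\<^bsub>Q\<^esub>"
  using euler_cocycle_eq[of "\<one>\<^bsub>Q\<^esub>" "\<one>\<^bsub>Q\<^esub>" a] euler_cocycle_eq[of a "\<one>\<^bsub>Q\<^esub>" "\<one>\<^bsub>Q\<^esub>"] assms by simp_all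

lemma p_funcset: "p \<in> carrier E \<rightarrow> carrier Q"
  by auto

section \<open>Cap products with the Euler cocycle and the fibre cochain\<close>

abbreviation cap_e where "cap_e \<equiv> cap_chain 2 (euler_cocycle E Q p T)"
abbreviation cap_\<eta> where "cap_\<eta> \<equiv> cap_chain 1 (fibre_cochain E p T)"

text \<open>Capping with a cocycle of even degree commutes with the boundary without sign: the
  coefficients of the first three faces combine to \<open>e a b\<close>. This degree makes the Thom
  chain of a relative cycle a cycle; \<open>cap_e_boundary_5\<close> handles relative
  boundaries.\<close>

lemma cap_e_boundary_4:
  assumes "c \<in> bar_chains Q 4"
  shows "cap_e (bar_boundary Q c) = bar_boundary Q (cap_e c)"
  using assms[unfolded bar_chains_iff]
proof (rule frag_additive_eq)
  fix xs assume "xs \<in> bar_tuples Q 4"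
  then obtain a b c d where abc: "a \<in> carrier Q" "b \<in> carrier Q" "c \<in> carrier Q" and xs: "xs = [a, b, c, d]"
    by (auto simp: bar_tuples_4)
  have ebc: "e b c = e (a \<star> b) c + e a b - e a (b \<star> c)"
    using euler_cocycle_eq[OF abc] by simp
  show "cap_e (bar_boundary Q (frag_of xs)) = bar_boundary Q (cap_e (frag_of xs))"
    unfolding xs by (simp add: ebc bar_boundary_4 bar_boundary_2 bar_boundary_simps cap_chain_simps
      frag_simps algebra_simps)
qed (auto simp: bar_boundary_simps cap_chain_simps)

lemma cap_e_boundary_5:
  assumes "c \<in> bar_chains Q 5"
  shows "cap_e (bar_boundary Q c) = bar_boundary Q (cap_e c)"
  using assms[unfolded bar_chains_iff]
proof (rule frag_additive_eq)
  fix xs assume "xs \<in> bar_tuples Q 5"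
  then obtain a b c d f where abc: "a \<in> carrier Q" "b \<in> carrier Q" "c \<in> carrier Q" and xs: "xs = [a, b, c, d, f]"
    by (auto simp: bar_tuples_5)
  have ebc: "e b c = e (a \<star> b) c + e a b - e a (b \<star> c)"
    using euler_cocycle_eq[OF abc] by simp
  show "cap_e (bar_boundary Q (frag_of xs)) = bar_boundary Q (cap_e (frag_of xs))"
    unfolding xs by (simp add: ebc bar_boundary_5 bar_boundary_3 bar_boundary_simps cap_chain_simps
      frag_simps algebra_simps)
qed (auto simp: bar_boundary_simps cap_chain_simps)

text \<open>The sign comes from the odd degree of \<eta>, the defect
  \<open>cap_e (bar_map p t)\<close> from \<open>\<delta>\<eta> = - p^*e\<close>. In the Thom chain
  the defect cancels against the contribution of the base chain.\<close>

lemma cap_\<eta>_boundary_3: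
  assumes "t \<in> bar_chains E 3"
  shows "bar_map p (cap_\<eta> (bar_boundary E t)) = - bar_boundary Q (bar_map p (cap_\<eta> t)) - cap_e (bar_map p t)"
  using assms[unfolded bar_chains_iff]
proof (rule frag_additive_eq)
  fix xs assume "xs \<in> bar_tuples E 3"
  then obtain x y z where mem: "x \<in> carrier E" "y \<in> carrier E" "z \<in> carrier E" and xs: "xs = [x, y, z]"
    by (auto simp: bar_tuples_3)
  then show "bar_map p (cap_\<eta> (bar_boundary E (frag_of xs)))
      = - bar_boundary Q (bar_map p (cap_\<eta> (frag_of xs))) - cap_e (bar_map p (frag_of xs))"
    unfolding xs using mem by (simp add: eta_mult bar_boundary_3 bar_boundary_2 bar_boundary_simps cap_chain_simps bar_map_simps
      frag_simps algebra_simps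
      del: minus_frag_cmul)
qed (auto simp: bar_boundary_simps cap_chain_simps bar_map_simps)

lemma cap_\<eta>_boundary_4:
  assumes "t \<in> bar_chains E 4"
  shows "bar_map p (cap_\<eta> (bar_boundary E t)) = - bar_boundary Q (bar_map p (cap_\<eta> t)) - cap_e (bar_map p t)"
  using assms[unfolded bar_chains_iff]
proof (rule frag_additive_eq)
  fix xs assume "xs \<in> bar_tuples E 4"
  then obtain x y z w where mem: "x \<in> carrier E" "y \<in> carrier E" "z \<in> carrier E" "w \<in> carrier E"
    and xs: "xs = [x, y, z, w]"
    by (auto simp: bar_tuples_4)
  then show "bar_map p (cap_\<eta> (bar_boundary E (frag_of xs)))
      = - bar_boundary Q (bar_map p (cap_\<eta> (frag_of xs))) - cap_e (bar_map p (frag_of xs))"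
    unfolding xs using mem by (simp add: eta_mult bar_boundary_4 bar_boundary_3 bar_boundary_simps cap_chain_simps bar_map_simps
      frag_simps algebra_simps
      del: minus_frag_cmul)
qed (auto simp: bar_boundary_simps cap_chain_simps bar_map_simps)

lemma cap_e_chains:
  assumes "c \<in> bar_chains Q (2 + n)"
  shows "cap_e c \<in> bar_chains Q n"
  unfolding cap_chain_def using assms
  by (rule frag_extend_bar_chains)
    (auto intro!: frag_cmul_bar_chains simp: bar_tuples_def dest!: in_set_dropD)

lemma cap_\<eta>_chains:
  assumes "t \<in> bar_chains E (1 + n)"
  shows "cap_\<eta> t \<in> bar_chains E n"
  unfolding cap_chain_def using assms
  by (rule frag_extend_bar_chains)
    (auto intro!: frag_cmul_bar_chains simp: bar_tuples_def dest!: in_set_dropD)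

end

section \<open>Averaging over powers of the central element\<close>

definition int_mean :: "nat \<Rightarrow> (int \<Rightarrow> rat) \<Rightarrow> rat"
  where "int_mean k f = (\<Sum>i<k. f (int i)) / of_nat k"

lemma int_mean_add: "int_mean k (\<lambda>i. f i + g i) = int_mean k f + int_mean k g"
  by (simp add: int_mean_def sum.distrib add_divide_distrib)

lemma int_mean_diff: "int_mean k (\<lambda>i. f i - g i) = int_mean k f - int_mean k g"
  by (simp add: int_mean_def sum_subtractf diff_divide_distrib)

lemma int_mean_const: "k > 0 \<Longrightarrow> int_mean k (\<lambda>i. c) = c"
  by (simp add: int_mean_def)

text \<open>Moving a window of length \<open>k\<close> by one step drops \<open>f m\<close> and
  gains \<open>f (m + int k)\<close>, which agree.\<close>

lemma int_mean_shift:
  assumes "\<And>i. f (i + int k) = f i"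
  shows "int_mean k (\<lambda>i. f (n + i)) = int_mean k f"
proof -
  define S where "S m = (\<Sum>i<k. f (m + int i))" for m
  have step: "S (m + 1) = S m" for m
  proof -
    have "(\<Sum>i<k. f (m + 1 + int i)) - (\<Sum>i<k. f (m + int i)) = f (m + int k) - f m"
      using sum_lessThan_telescope[of "\<lambda>i. f (m + int i)" k]
      by (simp add: sum_subtractf[symmetric] add_ac)
    then show ?thesis using assms[of m] by (simp add: S_def)
  qed
  have "S n = S 0"
  proof (induction n rule: int_induct[where k = 0])
    case (step2 i)
    then show ?case using step[of "i - 1"] by simp
  qed (simp_all add: step)
  then show ?thesis by (simp add: int_mean_def S_def)
qed

context central_Z_extension
begin

text \<open>Invariance in each entry separately expresses that \<open>z\<close> is a cochain of the
  quotient of \<open>E\<close> by \<open>T^k\<close>, without forming that quotient.\<close>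

definition shift_invariant :: "nat \<Rightarrow> ('e \<Rightarrow> 'e \<Rightarrow> 'e \<Rightarrow> rat) \<Rightarrow> bool"
  where "shift_invariant k z \<longleftrightarrow> (\<forall>x\<in>carrier E. \<forall>y\<in>carrier E. \<forall>u\<in>carrier E.
    z (tp (int k) \<cdot> x) y u = z x y u \<and> z x (tp (int k) \<cdot> y) u = z x y u \<and> z x y (tp (int k) \<cdot> u) = z x y u)"

definition cocycle3 :: "('e \<Rightarrow> 'e \<Rightarrow> 'e \<Rightarrow> rat) \<Rightarrow> bool"
  where "cocycle3 z \<longleftrightarrow> (\<forall>x\<in>carrier E. \<forall>y\<in>carrier E. \<forall>u\<in>carrier E. \<forall>v\<in>carrier E.
    z y u v - z (x \<cdot> y) u v + z x (y \<cdot> u) v - z x y (u \<cdot> v) + z x y u = 0)"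

lemma tp_mult_tp:
  assumes "x \<in> carrier E" "y \<in> carrier E"
  shows "(tp i \<cdot> x) \<cdot> (tp j \<cdot> y) = tp (i + j) \<cdot> (x \<cdot> y)"
proof -
  have "(tp i \<cdot> x) \<cdot> (tp j \<cdot> y) = tp i \<cdot> ((x \<cdot> tp j) \<cdot> y)"
    using assms by (simp add: E.m_assoc)
  also have "\<dots> = tp i \<cdot> ((tp j \<cdot> x) \<cdot> y)"
    using assms by (simp add: tp_central)
  finally show ?thesis
    using assms by (simp add: tp_add E.m_assoc)
qed

lemma tp_mult_left:
  assumes "x \<in> carrier E" "y \<in> carrier E"
  shows "x \<cdot> (tp j \<cdot> y) = tp j \<cdot> (x \<cdot> y)" "(tp j \<cdot> x) \<cdot> y = tp j \<cdot> (x \<cdot> y)"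
  using tp_mult_tp[OF assms, of 0 j] tp_mult_tp[OF assms, of j 0] assms by simp_all

text \<open>
  In homogeneous coordinates \<open>x_0, ..., x_3\<close> the mean translates the four vertices
  independently by powers of \<open>T\<close>; the prism operator gives the homotopy to the identity.
\<close>

lemma mean_homotopy:
  assumes k: "k > 0" and inv: "shift_invariant k z" and coc: "cocycle3 z"
    and mem: "x \<in> carrier E" "y \<in> carrier E" "w \<in> carrier E"
  defines "M \<equiv> int_mean k"
  defines "h \<equiv> \<lambda>x y. M (\<lambda>i. M (\<lambda>j. M (\<lambda>l. z (tp i) (tp j \<cdot> x) (tp l \<cdot> y))))
    - M (\<lambda>i. M (\<lambda>j. z x (tp i) (tp j \<cdot> y))) + M (\<lambda>i. z x y (tp i))"
  shows "M (\<lambda>i. M (\<lambda>j. M (\<lambda>l. z (tp i \<cdot> x) (tp j \<cdot> y) (tp l \<cdot> w)))) - z x y w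
    = h y w - h (x \<cdot> y) w + h x (y \<cdot> w) - h x y"
proof -
  note [simp] = mem
  have const: "M (\<lambda>i. c) = c" for c
    unfolding M_def using k by (rule int_mean_const)
  \<comment> \<open>Invariance under \<open>T^k\<close> turns each mean into one over residues
    modulo \<open>k\<close>, so a further translation of an averaged entry is absorbed.\<close>
  have shift: "M (\<lambda>j. g (tp (n + j) \<cdot> a)) = M (\<lambda>j. g (tp j \<cdot> a))"
    if "a \<in> carrier E" "\<And>b. b \<in> carrier E \<Longrightarrow> g (tp (int k) \<cdot> b) = g b" for n a g
  proof -
    have "tp (i + int k) \<cdot> a = tp (int k) \<cdot> (tp i \<cdot> a)" for i
      using that(1) by (simp only: add.commute[of i] tp_add E.m_assoc tp_mem)
    then show ?thesis
      unfolding M_def using that by (intro int_mean_shift) simp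
  qed
  have z: "z (tp (int k) \<cdot> a) b c = z a b c" "z a (tp (int k) \<cdot> b) c = z a b c" "z a b (tp (int k) \<cdot> c) = z a b c"
    if "a \<in> carrier E" "b \<in> carrier E" "c \<in> carrier E" for a b c
    using inv that by (auto simp: shift_invariant_def)
  have D: "z b c d - z (a \<cdot> b) c d + z a (b \<cdot> c) d - z a b (c \<cdot> d) + z a b c = 0"
    if "a \<in> carrier E" "b \<in> carrier E" "c \<in> carrier E" "d \<in> carrier E" for a b c d
    using coc that by (auto simp: cocycle3_def)
  \<comment> \<open>The three terms of \<open>h\<close> differ in the position at which a power of
    \<open>T\<close> is inserted. Below, \<open>zb\<close>, \<open>z1\<close> and \<open>z2\<close>
    average over all entries, the last two, and the last one.\<close>
  define h1 where "h1 a b = M (\<lambda>i. M (\<lambda>j. M (\<lambda>l. z (tp i) (tp j \<cdot> a) (tp l \<cdot> b))))" for a b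
  define h2 where "h2 a b = M (\<lambda>i. M (\<lambda>j. z a (tp i) (tp j \<cdot> b)))" for a b
  define h3 where "h3 a b = M (\<lambda>i. z a b (tp i))" for a b
  define zb where "zb = M (\<lambda>i. M (\<lambda>j. M (\<lambda>l. z (tp i \<cdot> x) (tp j \<cdot> y) (tp l \<cdot> w))))"
  define z1 where "z1 = M (\<lambda>j. M (\<lambda>l. z x (tp j \<cdot> y) (tp l \<cdot> w)))"
  define z2 where "z2 = M (\<lambda>l. z x y (tp l \<cdot> w))"
  note lin = int_mean_add[of k, folded M_def] int_mean_diff[of k, folded M_def]

  have s1: "M (\<lambda>j. M (\<lambda>l. M (\<lambda>m. z (tp (i + j) \<cdot> x) (tp l \<cdot> y) (tp m \<cdot> w)))) = zb" for i
    unfolding zb_def by (rule shift[where g = "\<lambda>b. M (\<lambda>l. M (\<lambda>m. z b (tp l \<cdot> y) (tp m \<cdot> w)))"]) (auto simp: z)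
  have s2: "M (\<lambda>l. M (\<lambda>m. z (tp i) (tp (j + l) \<cdot> (x \<cdot> y)) (tp m \<cdot> w)))
      = M (\<lambda>l. M (\<lambda>m. z (tp i) (tp l \<cdot> (x \<cdot> y)) (tp m \<cdot> w)))" for i j
    by (rule shift[where g = "\<lambda>b. M (\<lambda>m. z (tp i) b (tp m \<cdot> w))"]) (auto simp: z)
  have s3: "M (\<lambda>m. z (tp i) (tp j \<cdot> x) (tp (l + m) \<cdot> (y \<cdot> w)))
      = M (\<lambda>m. z (tp i) (tp j \<cdot> x) (tp m \<cdot> (y \<cdot> w)))" for i j l
    by (rule shift[where g = "\<lambda>b. z (tp i) (tp j \<cdot> x) b"]) (auto simp: z)
  \<comment> \<open>The cocycle identity with \<open>T^i\<close> inserted in front of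
    \<open>x, y, w\<close>; the three later blocks insert it one place further each time. Every
    entry after the insertion carries its own independent translation.\<close>
  have "z (tp j \<cdot> x) (tp l \<cdot> y) (tp m \<cdot> w) - z (tp (i + j) \<cdot> x) (tp l \<cdot> y) (tp m \<cdot> w)
    + z (tp i) (tp (j + l) \<cdot> (x \<cdot> y)) (tp m \<cdot> w) - z (tp i) (tp j \<cdot> x) (tp (l + m) \<cdot> (y \<cdot> w))
    + z (tp i) (tp j \<cdot> x) (tp l \<cdot> y) = 0" for i j l m
  proof -
    have "tp i \<cdot> (tp j \<cdot> x) = tp (i + j) \<cdot> x"
      by (simp add: tp_add E.m_assoc)
    then show ?thesis
      using D[of "tp i" "tp j \<cdot> x" "tp l \<cdot> y" "tp m \<cdot> w"] by (simp add: tp_mult_tp)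
  qed
  then have "M (\<lambda>i. M (\<lambda>j. M (\<lambda>l. M (\<lambda>m.
      z (tp j \<cdot> x) (tp l \<cdot> y) (tp m \<cdot> w) - z (tp (i + j) \<cdot> x) (tp l \<cdot> y) (tp m \<cdot> w)
    + z (tp i) (tp (j + l) \<cdot> (x \<cdot> y)) (tp m \<cdot> w) - z (tp i) (tp j \<cdot> x) (tp (l + m) \<cdot> (y \<cdot> w))
    + z (tp i) (tp j \<cdot> x) (tp l \<cdot> y))))) = 0"
    by (simp only: const)
  then have e1: "h1 (x \<cdot> y) w - h1 x (y \<cdot> w) + h1 x y = 0"
    by (simp only: lin s1 s2 s3 const zb_def[symmetric] h1_def[symmetric])

  have s1: "M (\<lambda>j. M (\<lambda>l. z x (tp (i + j) \<cdot> y) (tp l \<cdot> w))) = z1" for i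
    unfolding z1_def by (rule shift[where g = "\<lambda>b. M (\<lambda>l. z x b (tp l \<cdot> w))"]) (auto simp: z)
  have s2: "M (\<lambda>l. z x (tp i) (tp (j + l) \<cdot> (y \<cdot> w))) = M (\<lambda>l. z x (tp i) (tp l \<cdot> (y \<cdot> w)))" for i j
    by (rule shift[where g = "\<lambda>b. z x (tp i) b"]) (auto simp: z)
  have "z (tp i) (tp j \<cdot> y) (tp l \<cdot> w) - z (tp i \<cdot> x) (tp j \<cdot> y) (tp l \<cdot> w)
    + z x (tp (i + j) \<cdot> y) (tp l \<cdot> w) - z x (tp i) (tp (j + l) \<cdot> (y \<cdot> w)) + z x (tp i) (tp j \<cdot> y) = 0" for i j l
  proof -
    have "tp i \<cdot> (tp j \<cdot> y) = tp (i + j) \<cdot> y"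
      by (simp add: tp_add E.m_assoc)
    then show ?thesis
      using D[of x "tp i" "tp j \<cdot> y" "tp l \<cdot> w"] by (simp add: tp_mult_tp tp_central[of x i])
  qed
  then have "M (\<lambda>i. M (\<lambda>j. M (\<lambda>l.
      z (tp i) (tp j \<cdot> y) (tp l \<cdot> w) - z (tp i \<cdot> x) (tp j \<cdot> y) (tp l \<cdot> w)
    + z x (tp (i + j) \<cdot> y) (tp l \<cdot> w) - z x (tp i) (tp (j + l) \<cdot> (y \<cdot> w)) + z x (tp i) (tp j \<cdot> y)))) = 0"
    by (simp only: const)
  then have e2: "h1 y w - zb + z1 - h2 x (y \<cdot> w) + h2 x y = 0"
    by (simp only: lin s1 s2 const zb_def[symmetric] h1_def[symmetric] h2_def[symmetric])

  have s1: "M (\<lambda>j. z x y (tp (i + j) \<cdot> w)) = z2" for i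
    unfolding z2_def by (rule shift[where g = "\<lambda>b. z x y b"]) (auto simp: z)
  have "z y (tp i) (tp j \<cdot> w) - z (x \<cdot> y) (tp i) (tp j \<cdot> w) + z x (tp i \<cdot> y) (tp j \<cdot> w)
    - z x y (tp (i + j) \<cdot> w) + z x y (tp i) = 0" for i j
  proof -
    have "tp i \<cdot> (tp j \<cdot> w) = tp (i + j) \<cdot> w"
      by (simp add: tp_add E.m_assoc)
    then show ?thesis
      using D[of x y "tp i" "tp j \<cdot> w"] by (simp add: tp_central[of y i])
  qed
  then have "M (\<lambda>i. M (\<lambda>j.
      z y (tp i) (tp j \<cdot> w) - z (x \<cdot> y) (tp i) (tp j \<cdot> w) + z x (tp i \<cdot> y) (tp j \<cdot> w)
    - z x y (tp (i + j) \<cdot> w) + z x y (tp i))) = 0"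
    by (simp only: const)
  then have e3: "h2 y w - h2 (x \<cdot> y) w + z1 - z2 + h3 x y = 0"
    by (simp only: lin s1 const z1_def[symmetric] h2_def[symmetric] h3_def[symmetric])

  have "z y w (tp i) - z (x \<cdot> y) w (tp i) + z x (y \<cdot> w) (tp i) - z x y (tp i \<cdot> w) + z x y w = 0" for i
    using D[of x y w "tp i"] by (simp add: tp_central[of w i])
  then have "M (\<lambda>i. z y w (tp i) - z (x \<cdot> y) w (tp i) + z x (y \<cdot> w) (tp i) - z x y (tp i \<cdot> w) + z x y w) = 0"
    by (simp only: const)
  then have e4: "h3 y w - h3 (x \<cdot> y) w + h3 x (y \<cdot> w) - z2 + z x y w = 0"
    by (simp only: lin const z2_def[symmetric] h3_def[symmetric])

  have h: "h a b = h1 a b - h2 a b + h3 a b" for a b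
    by (simp add: h_def h1_def h2_def h3_def)
  \<comment> \<open>The alternating sum \<open>e1 - e2 + e3 - e4\<close>, in which the partial means
    \<open>z1\<close> and \<open>z2\<close> cancel.\<close>
  show ?thesis
    using e1 e2 e3 e4 unfolding zb_def[symmetric] h by linarith
qed

lemma frag_eval_3_cong:
  assumes "t \<in> bar_chains G 3"
    "\<And>x y w. x \<in> carrier G \<Longrightarrow> y \<in> carrier G \<Longrightarrow> w \<in> carrier G \<Longrightarrow> u [x, y, w] = v [x, y, w]"
  shows "frag_eval u t = frag_eval v t"
  using assms by (intro frag_eval_cong[where S = "bar_tuples G 3"]) (auto simp: bar_chains_iff bar_tuples_3)

lemma frag_eval_4_eq_0:
  assumes "t \<in> bar_chains G 4"
    "\<And>a b c d. a \<in> carrier G \<Longrightarrow> b \<in> carrier G \<Longrightarrow> c \<in> carrier G \<Longrightarrow> d \<in> carrier G \<Longrightarrow> u [a, b, c, d] = 0"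
  shows "frag_eval u t = 0"
proof -
  have "frag_eval u t = frag_eval (\<lambda>_. 0) t"
    using assms by (intro frag_eval_cong[where S = "bar_tuples G 4"]) (auto simp: bar_chains_iff bar_tuples_4)
  then show ?thesis by (simp add: frag_eval_def)
qed

abbreviation eval3 :: "('g \<Rightarrow> 'g \<Rightarrow> 'g \<Rightarrow> rat) \<Rightarrow> ('g list \<Rightarrow>\<^sub>0 int) \<Rightarrow> rat"
  where "eval3 z \<equiv> frag_eval (\<lambda>xs. z (xs ! 0) (xs ! 1) (xs ! 2))"

lemma eval3_boundary:
  assumes "cocycle3 z" "t \<in> bar_chains E 4"
  shows "eval3 z (bar_boundary E t) = 0"
  unfolding frag_eval_boundary[of _ E t] using assms(2)
  by (rule frag_eval_4_eq_0)
    (use assms(1) in \<open>simp add: bar_boundary_4 frag_eval_simps cocycle3_def numeral_2_eq_2\<close>)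

lemma eval3_coboundary:
  assumes "t \<in> bar_chains E 3" "bar_boundary E t = 0"
  shows "eval3 (\<lambda>x y w. h y w - h (x \<cdot> y) w + h x (y \<cdot> w) - h x y) t = 0"
proof -
  have "frag_eval (\<lambda>xs. h (xs ! 0) (xs ! 1)) (bar_boundary E t) = 0"
    using assms(2) by simp
  also have "frag_eval (\<lambda>xs. h (xs ! 0) (xs ! 1)) (bar_boundary E t)
      = eval3 (\<lambda>x y w. h y w - h (x \<cdot> y) w + h x (y \<cdot> w) - h x y) t"
    unfolding frag_eval_boundary[of _ E t] using assms(1)
    by (rule frag_eval_3_cong) (simp add: bar_boundary_3 frag_eval_simps numeral_2_eq_2)
  finally show ?thesis .
qed

text \<open>
  An invariant cocycle lives on the quotient of \<open>E\<close> by \<open>T^k\<close>, whose rational homology is that of \<open>Q\<close>.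
\<close>

lemma eval3_shift_invariant:
  assumes k: "k > 0" and inv: "shift_invariant k z" and coc: "cocycle3 z"
    and t: "t \<in> bar_chains E 3" "bar_boundary E t = 0"
    and c: "c \<in> bar_chains Q 4" "bar_boundary Q c = bar_map p t"
  shows "eval3 z t = 0"
proof -
  define M where "M = int_mean k"
  define h where "h x y = M (\<lambda>i. M (\<lambda>j. M (\<lambda>l. z (tp i) (tp j \<cdot> x) (tp l \<cdot> y))))
    - M (\<lambda>i. M (\<lambda>j. z x (tp i) (tp j \<cdot> y))) + M (\<lambda>i. z x y (tp i))" for x y
  define zb where "zb x y w = M (\<lambda>i. M (\<lambda>j. M (\<lambda>l. z (tp i \<cdot> x) (tp j \<cdot> y) (tp l \<cdot> w))))" for x y w
  have hom: "zb x y w - z x y w = h y w - h (x \<cdot> y) w + h x (y \<cdot> w) - h x y"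
    if "x \<in> carrier E" "y \<in> carrier E" "w \<in> carrier E" for x y w
    using mean_homotopy[OF k inv coc that] by (simp add: zb_def h_def M_def)
  have zb_coc: "cocycle3 zb"
    unfolding cocycle3_def
  proof (intro ballI)
    fix x y u v assume m: "x \<in> carrier E" "y \<in> carrier E" "u \<in> carrier E" "v \<in> carrier E"
    have "z y u v - z (x \<cdot> y) u v + z x (y \<cdot> u) v - z x y (u \<cdot> v) + z x y u = 0"
      using coc m by (simp add: cocycle3_def)
    moreover note hom[of y u v] hom[of "x \<cdot> y" u v] hom[of x "y \<cdot> u" v] hom[of x y "u \<cdot> v"] hom[of x y u]
    ultimately show "zb y u v - zb (x \<cdot> y) u v + zb x (y \<cdot> u) v - zb x y (u \<cdot> v) + zb x y u = 0"
      using m by (simp add: E.m_assoc)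
  qed
  have z: "z (tp (int k) \<cdot> a) b c = z a b c" "z a (tp (int k) \<cdot> b) c = z a b c" "z a b (tp (int k) \<cdot> c) = z a b c"
    if "a \<in> carrier E" "b \<in> carrier E" "c \<in> carrier E" for a b c
    using inv that by (auto simp: shift_invariant_def)
  have shift: "M (\<lambda>j. g (tp j \<cdot> (tp n \<cdot> a))) = M (\<lambda>j. g (tp j \<cdot> a))"
    if "a \<in> carrier E" "\<And>b. b \<in> carrier E \<Longrightarrow> g (tp (int k) \<cdot> b) = g b" for n a g
  proof -
    have "tp (i + int k) \<cdot> a = tp (int k) \<cdot> (tp i \<cdot> a)" for i
      using that(1) by (simp only: add.commute[of i] tp_add E.m_assoc tp_mem)
    moreover have "tp j \<cdot> (tp n \<cdot> a) = tp (n + j) \<cdot> a" for j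
      using that(1) by (simp only: add.commute[of n] tp_add E.m_assoc tp_mem)
    ultimately show ?thesis
      unfolding M_def using that int_mean_shift[of "\<lambda>j. g (tp j \<cdot> a)" k n] by simp
  qed
  have zb_tp: "zb (tp n \<cdot> x) (tp m \<cdot> y) (tp r \<cdot> w) = zb x y w"
    if "x \<in> carrier E" "y \<in> carrier E" "w \<in> carrier E" for n m r x y w
  proof -
    have "zb (tp n \<cdot> x) (tp m \<cdot> y) (tp r \<cdot> w) = zb x (tp m \<cdot> y) (tp r \<cdot> w)"
      unfolding zb_def
      by (rule shift[where g = "\<lambda>b. M (\<lambda>j. M (\<lambda>l. z b (tp j \<cdot> (tp m \<cdot> y)) (tp l \<cdot> (tp r \<cdot> w))))"])
        (use that in \<open>auto simp: z\<close>)
    also have "\<dots> = zb x y (tp r \<cdot> w)"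
      unfolding zb_def
      by (subst shift[where g = "\<lambda>b. M (\<lambda>l. z (tp i \<cdot> x) b (tp l \<cdot> (tp r \<cdot> w)))" for i])
        (use that in \<open>auto simp: z\<close>)
    also have "\<dots> = zb x y w"
      unfolding zb_def
      by (subst shift[where g = "\<lambda>b. z (tp i \<cdot> x) (tp j \<cdot> y) b" for i j])
        (use that in \<open>auto simp: z\<close>)
    finally show ?thesis .
  qed
  \<comment> \<open>The mean is invariant under all powers of \<open>T\<close> in every entry, and
    \<open>x\<close> differs from \<open>s (p x)\<close> by such a power. Evaluation on section
    values therefore gives a cocycle of \<open>Q\<close> that pulls back to
    \<open>zb\<close>.\<close>
  define zq where "zq a b c = zb (s a) (s b) (s c)" for a b c
  have zb_zq: "zb x y w = zq (p x) (p y) (p w)"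
    if "x \<in> carrier E" "y \<in> carrier E" "w \<in> carrier E" for x y w
    using zb_tp[of "s (p x)" "s (p y)" "s (p w)" "\<eta> x" "\<eta> y" "\<eta> w"] that
    by (simp add: eta_eq zq_def)
  have "eval3 zb t = eval3 zq (bar_map p t)"
    unfolding frag_eval_bar_map using t(1)
    by (rule frag_eval_3_cong) (simp add: zb_zq)
  \<comment> \<open>The image of \<open>t\<close> in \<open>Q\<close> is the boundary of
    \<open>c\<close>, and a cocycle vanishes on boundaries.\<close>
  also have "\<dots> = 0"
    unfolding c(2)[symmetric] frag_eval_boundary[of _ Q c] using c(1)
  proof (rule frag_eval_4_eq_0)
    fix a b c d assume m: "a \<in> carrier Q" "b \<in> carrier Q" "c \<in> carrier Q" "d \<in> carrier Q"
    have "zb (s b) (s c) (s d) - zb (s a \<cdot> s b) (s c) (s d) + zb (s a) (s b \<cdot> s c) (s d)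
      - zb (s a) (s b) (s c \<cdot> s d) + zb (s a) (s b) (s c) = 0"
      using zb_coc m by (simp add: cocycle3_def)
    then show "frag_eval (\<lambda>xs. zq (xs ! 0) (xs ! 1) (xs ! 2)) (bar_boundary Q (frag_of [a, b, c, d])) = 0"
      using m by (simp add: bar_boundary_4 frag_eval_simps zb_zq numeral_2_eq_2)
  qed
  finally have "eval3 zb t = 0" .
  moreover have "eval3 zb t - eval3 z t = eval3 (\<lambda>x y w. h y w - h (x \<cdot> y) w + h x (y \<cdot> w) - h x y) t"
    unfolding frag_eval_fun_diff[symmetric] using t(1)
    by (rule frag_eval_3_cong) (use hom in \<open>simp add: numeral_2_eq_2\<close>)
  ultimately show ?thesis
    using eval3_coboundary[OF t] by simp
qed

end

section \<open>The Thom isomorphism in degree two and the Euler square\<close>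

context central_Z_extension
begin

definition euler_square_primitive :: "('q \<Rightarrow> 'q \<Rightarrow> 'q \<Rightarrow> rat) \<Rightarrow> bool"
  where "euler_square_primitive v \<longleftrightarrow>
    (\<forall>a\<in>carrier Q. \<forall>b\<in>carrier Q. \<forall>c\<in>carrier Q. \<forall>d\<in>carrier Q.
      v b c d - v (a \<star> b) c d + v a (b \<star> c) d - v a b (c \<star> d) + v a b c = of_int (e a b) * of_int (e c d))"

definition theta :: "('q \<Rightarrow> 'q \<Rightarrow> 'q \<Rightarrow> rat) \<Rightarrow> 'e \<Rightarrow> 'e \<Rightarrow> 'e \<Rightarrow> rat"
  where "theta v x y w = of_int (\<eta> x) * of_int (e (p y) (p w)) + v (p x) (p y) (p w)"

text \<open>From \<open>\<delta>\<eta> = - p^*e\<close> and \<open>\<delta>e = 0\<close>, the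
  coboundary of the product of \<eta> with \<open>p^*e\<close> is minus the pulled-back square of
  \<open>e\<close>, which the term in \<open>v\<close> cancels.\<close>

lemma theta_cocycle:
  assumes "euler_square_primitive v"
  shows "cocycle3 (theta v)"
  unfolding cocycle3_def
proof (intro ballI)
  fix x y u w assume m: "x \<in> carrier E" "y \<in> carrier E" "u \<in> carrier E" "w \<in> carrier E"
  have v: "v (p y) (p u) (p w) - v (p x \<star> p y) (p u) (p w) + v (p x) (p y \<star> p u) (p w)
      - v (p x) (p y) (p u \<star> p w) + v (p x) (p y) (p u) = of_int (e (p x) (p y)) * of_int (e (p u) (p w))"
    using assms m by (simp add: euler_square_primitive_def)
  have e: "of_int (e (p y) (p u)) = (of_int (e (p u) (p w)) + of_int (e (p y) (p u \<star> p w))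
      - of_int (e (p y \<star> p u) (p w)) :: rat)"
    using arg_cong[OF euler_cocycle_eq[of "p y" "p u" "p w"], of "of_int :: int \<Rightarrow> rat"] m by simp
  show "theta v y u w - theta v (x \<cdot> y) u w + theta v x (y \<cdot> u) w - theta v x y (u \<cdot> w) + theta v x y u = 0"
    using v m by (simp add: theta_def eta_mult e algebra_simps)
qed

text \<open>\<open>theta v\<close> integrates along the fibre to the Euler class.\<close>

lemma eval3_theta:
  assumes v: "euler_square_primitive v" and c: "c \<in> bar_chains Q 4" and t: "t \<in> bar_chains E 3"
    and ct: "bar_boundary Q c = bar_map p t"
  shows "eval3 (theta v) t = of_int (eval_cochain (euler_cocycle E Q p T) (thom_chain E Q p T (c, t)))"
proof -
  let ?e = "\<lambda>xs. of_int (euler_cocycle E Q p T xs) :: rat"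
  \<comment> \<open>Cap-cup adjointness: \<open>e\<close> on its cap with \<open>c\<close> is the
    square of \<open>e\<close> on \<open>c\<close>, hence the coboundary of \<open>v\<close> on
    \<open>c\<close>, hence \<open>v\<close> on the boundary of \<open>c\<close>.\<close>
  have "frag_eval ?e (cap_e c) = eval3 v (bar_boundary Q c)"
  proof -
    have "frag_eval (\<lambda>xs. ?e (take 2 xs) * ?e (drop 2 xs)
        - frag_eval (\<lambda>xs. v (xs ! 0) (xs ! 1) (xs ! 2)) (bar_boundary Q (frag_of xs))) c = 0"
      using c by (rule frag_eval_4_eq_0)
        (use v in \<open>simp add: euler_square_primitive_def bar_boundary_4 frag_eval_simps numeral_2_eq_2\<close>)
    then show ?thesis
      unfolding frag_eval_boundary[of _ Q c] frag_eval_cap_chain by (simp add: frag_eval_fun_diff)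
  qed
  also have "\<dots> = eval3 (\<lambda>x y w. v (p x) (p y) (p w)) t"
    unfolding ct frag_eval_bar_map using t by (rule frag_eval_3_cong) simp
  finally have "frag_eval ?e (cap_e c) = eval3 (\<lambda>x y w. v (p x) (p y) (p w)) t" .
  moreover have "frag_eval ?e (bar_map p (cap_\<eta> t)) = eval3 (\<lambda>x y w. of_int (\<eta> x) * of_int (e (p y) (p w))) t"
    unfolding frag_eval_bar_map frag_eval_cap_chain using t by (rule frag_eval_3_cong) simp
  moreover have "of_int (eval_cochain (euler_cocycle E Q p T) y) = frag_eval ?e y" for y
    by (simp add: eval_cochain_def frag_eval_def)
  moreover have "eval3 (theta v) t - eval3 (\<lambda>x y w. v (p x) (p y) (p w)) t
      = eval3 (\<lambda>x y w. of_int (\<eta> x) * of_int (e (p y) (p w))) t"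
    unfolding frag_eval_fun_diff[symmetric] by (simp add: theta_def)
  ultimately show ?thesis
    by (simp add: thom_chain_def frag_eval_add)
qed

section \<open>Surjectivity of the Thom map in degree two\<close>

lemma bar_boundary_boundary_3:
  assumes "y \<in> bar_chains Q 3"
  shows "bar_boundary Q (bar_boundary Q y) = 0"
  using assms[unfolded bar_chains_iff]
proof (rule frag_additive_eq)
  fix xs assume "xs \<in> bar_tuples Q 3"
  then show "bar_boundary Q (bar_boundary Q (frag_of xs)) = 0"
    by (auto simp: bar_tuples_3 bar_boundary_3 bar_boundary_2 bar_boundary_simps Q.m_assoc)
qed (auto simp: bar_boundary_simps)

lemma thom_chain_cycle:
  assumes "c \<in> bar_chains Q 4" "t \<in> bar_chains E 3" "bar_boundary Q c = bar_map p t" "bar_boundary E t = 0"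
  shows "bar_boundary Q (thom_chain E Q p T (c, t)) = 0"
proof -
  have "bar_boundary Q (bar_map p (cap_\<eta> t)) = - cap_e (bar_map p t)"
    using cap_\<eta>_boundary_3[OF assms(2)] assms(4) by (simp add: bar_map_simps cap_chain_simps algebra_simps)
  then show ?thesis
    using cap_e_boundary_4[OF assms(1)] assms(3) by (simp add: thom_chain_def bar_boundary_simps)
qed

text \<open>The boundary of \<open>[1|1]\<close> is \<open>[1]\<close>, not 0, so a cycle cannot be
  a nonzero multiple of \<open>[1|1]\<close> modulo boundaries. Errors in \<open>[1|1]\<close> thus
  need no explicit coefficient.\<close>

lemma degenerate_cycle_boundary:
  assumes "y - frag_cmul N (frag_of [\<one>\<^bsub>Q\<^esub>, \<one>\<^bsub>Q\<^esub>]) \<in> bar_boundaries Q 2" "bar_boundary Q y = 0"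
  shows "y \<in> bar_boundaries Q 2"
proof -
  obtain w where w: "w \<in> bar_chains Q 3" "y - frag_cmul N (frag_of [\<one>\<^bsub>Q\<^esub>, \<one>\<^bsub>Q\<^esub>]) = bar_boundary Q w"
    using assms(1) by (auto simp: bar_boundaries_def)
  have "bar_boundary Q (y - frag_cmul N (frag_of [\<one>\<^bsub>Q\<^esub>, \<one>\<^bsub>Q\<^esub>])) = 0"
    unfolding w(2) using w(1) by (rule bar_boundary_boundary_3)
  then have "frag_cmul N (frag_of [\<one>\<^bsub>Q\<^esub>]) = 0"
    using assms(2) by (simp add: bar_boundary_simps bar_boundary_2)
  then have "N = 0" by simp
  then show ?thesis using assms(1) by simp
qed

text \<open>The shuffle product of \<open>[T]\<close> with \<open>[x]\<close>;
  \<open>T_shuffle\<close> is the one with \<open>[x|y]\<close>. They represent the product of the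
  fibre circle with a chain.\<close>

definition T_commutator :: "'e \<Rightarrow> 'e list \<Rightarrow>\<^sub>0 int"
  where "T_commutator x = frag_of [T, x] - frag_of [x, T]"

definition T_shuffle :: "'e \<Rightarrow> 'e \<Rightarrow> 'e list \<Rightarrow>\<^sub>0 int"
  where "T_shuffle x y = frag_of [T, x, y] - frag_of [x, T, y] + frag_of [x, y, T]"

lemma T_shuffle_chain: "x \<in> carrier E \<Longrightarrow> y \<in> carrier E \<Longrightarrow> T_shuffle x y \<in> bar_chains E 3"
  unfolding T_shuffle_def using T_mem by (intro bar_chains_intros) (auto simp: bar_tuples_list)

text \<open>Centrality makes the faces that merge \<open>T\<close> with a neighbour cancel in pairs.
  What remains is minus the shuffle of \<open>[T]\<close> with the boundary of
  \<open>[x|y]\<close>.\<close>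

lemma boundary_T_shuffle:
  assumes "x \<in> carrier E" "y \<in> carrier E"
  shows "bar_boundary E (T_shuffle x y) = T_commutator (x \<cdot> y) - T_commutator x - T_commutator y"
  using assms by (simp add: T_shuffle_def T_commutator_def bar_boundary_simps bar_boundary_3 T_central)

text \<open>The boundary of \<open>[T|T^i|T]\<close> is the difference of the commutator chains at
  \<open>i + 1\<close> and \<open>i\<close>, so the filling telescopes in both directions. The
  images of the filling and of its cap with \<eta> stay multiples of a single degenerate
  tuple.\<close>

lemma T_commutator_tp_boundary:
  "\<exists>D\<in>bar_chains E 3. bar_boundary E D = T_commutator (tp n)
    \<and> (\<exists>N. bar_map p D = frag_cmul N (frag_of [\<one>\<^bsub>Q\<^esub>, \<one>\<^bsub>Q\<^esub>, \<one>\<^bsub>Q\<^esub>]))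
    \<and> (\<exists>N. bar_map p (cap_\<eta> D) = frag_cmul N (frag_of [\<one>\<^bsub>Q\<^esub>, \<one>\<^bsub>Q\<^esub>]))" (is "?P n")
proof -
  let ?d = "\<lambda>i. frag_of [T, tp i, T]"
  have d: "?d i \<in> bar_chains E 3" "bar_map p (?d i) = frag_of [\<one>\<^bsub>Q\<^esub>, \<one>\<^bsub>Q\<^esub>, \<one>\<^bsub>Q\<^esub>]"
    "bar_map p (cap_\<eta> (?d i)) = frag_cmul (\<eta> T) (frag_of [\<one>\<^bsub>Q\<^esub>, \<one>\<^bsub>Q\<^esub>])" for i
    using T_mem by (auto simp: bar_tuples_list bar_map_simps cap_chain_simps p_T)
  have bd: "bar_boundary E (?d i) = T_commutator (tp (i + 1)) - T_commutator (tp i)" for i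
    using T_mem by (simp add: bar_boundary_3 T_commutator_def tp_add T_central)
  have plus: "?P (i + 1)" if P: "?P i" for i
  proof -
    obtain D N N' where D: "D \<in> bar_chains E 3" "bar_boundary E D = T_commutator (tp i)"
      "bar_map p D = frag_cmul N (frag_of [\<one>\<^bsub>Q\<^esub>, \<one>\<^bsub>Q\<^esub>, \<one>\<^bsub>Q\<^esub>])"
      "bar_map p (cap_\<eta> D) = frag_cmul N' (frag_of [\<one>\<^bsub>Q\<^esub>, \<one>\<^bsub>Q\<^esub>])"
      using P by blast
    show ?thesis
    proof (intro bexI[of _ "D + ?d i"] conjI exI)
      show "bar_map p (D + ?d i) = frag_cmul (N + 1) (frag_of [\<one>\<^bsub>Q\<^esub>, \<one>\<^bsub>Q\<^esub>, \<one>\<^bsub>Q\<^esub>])"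
        by (simp add: bar_map_simps(1) D d frag_simps)
      show "bar_map p (cap_\<eta> (D + ?d i)) = frag_cmul (N' + \<eta> T) (frag_of [\<one>\<^bsub>Q\<^esub>, \<one>\<^bsub>Q\<^esub>])"
        by (simp add: bar_map_simps(1) cap_chain_simps(1) D d frag_simps del: One_nat_def)
    qed (auto simp: D bd bar_boundary_simps intro!: bar_chains_intros d D)
  qed
  have minus: "?P (i - 1)" if P: "?P i" for i
  proof -
    obtain D N N' where D: "D \<in> bar_chains E 3" "bar_boundary E D = T_commutator (tp i)"
      "bar_map p D = frag_cmul N (frag_of [\<one>\<^bsub>Q\<^esub>, \<one>\<^bsub>Q\<^esub>, \<one>\<^bsub>Q\<^esub>])"
      "bar_map p (cap_\<eta> D) = frag_cmul N' (frag_of [\<one>\<^bsub>Q\<^esub>, \<one>\<^bsub>Q\<^esub>])"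
      using P by blast
    show ?thesis
    proof (intro bexI[of _ "D - ?d (i - 1)"] conjI exI)
      show "bar_map p (D - ?d (i - 1)) = frag_cmul (N - 1) (frag_of [\<one>\<^bsub>Q\<^esub>, \<one>\<^bsub>Q\<^esub>, \<one>\<^bsub>Q\<^esub>])"
        by (simp add: bar_map_simps(2) D d frag_simps)
      show "bar_map p (cap_\<eta> (D - ?d (i - 1))) = frag_cmul (N' - \<eta> T) (frag_of [\<one>\<^bsub>Q\<^esub>, \<one>\<^bsub>Q\<^esub>])"
        by (simp add: bar_map_simps(2) cap_chain_simps(2) D d frag_simps del: One_nat_def)
    qed (auto simp: D bd bar_boundary_simps intro!: bar_chains_intros d D)
  qed
  \<comment> \<open>The induction starts at 1, where \<open>[T|T] - [T|T]\<close> is the zero chain;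
    at 0 the two terms \<open>[T|1]\<close> and \<open>[1|T]\<close> are different tuples.\<close>
  have "?P 1"
    by (intro bexI[of _ 0] conjI exI[of _ 0])
      (auto simp: bar_map_simps cap_chain_simps bar_boundary_simps T_commutator_def bar_chains_intros)
  then show "?P n"
  proof (induction n rule: int_induct[where k = 1])
    case (step1 i)
    then show ?case by (intro plus)
  next
    case (step2 i)
    then show ?case by (intro minus)
  qed
qed

text \<open>The cycle \<open>t\<close> is the total space of the circle bundle over
  \<open>x\<close>: each \<open>[a|b]\<close> is lifted by \<open>s\<close> and multiplied by the
  circle \<open>[T]\<close>. Since \<open>T\<close> maps to 1 and \<open>[1|1]\<close> bounds
  \<open>[1]\<close>, the base chain \<open>c\<close> is the associated disc bundle, built by
  shuffling \<open>[1|1]\<close> with \<open>[a|b]\<close>.\<close>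

lemma thom_surj:
  assumes x: "x \<in> bar_chains Q 2" "bar_boundary Q x = 0"
  obtains c t where "c \<in> bar_chains Q 4" "t \<in> bar_chains E 3" "bar_boundary Q c = bar_map p t"
    "bar_boundary E t = 0" "thom_chain E Q p T (c, t) - x \<in> bar_boundaries Q 2"
proof -
  let ?one = "\<one>\<^bsub>Q\<^esub>"
  obtain D N N' where D: "\<And>n. D n \<in> bar_chains E 3" "\<And>n. bar_boundary E (D n) = T_commutator (tp n)"
    "\<And>n. bar_map p (D n) = frag_cmul (N n) (frag_of [?one, ?one, ?one])"
    "\<And>n. bar_map p (cap_\<eta> (D n)) = frag_cmul (N' n) (frag_of [?one, ?one])"
    using T_commutator_tp_boundary by metis
  \<comment> \<open>The lift of \<open>[a|b]\<close> has edge \<open>s a \<cdot> s b\<close> instead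
    of \<open>s (a \<star> b)\<close>. The second shuffle corrects this by \<open>T\<close> to the
    power \<open>e a b\<close>, and \<open>D\<close> fills the commutator chain of that power, so
    the boundary of \<open>\<tau> a b\<close> depends only on that of \<open>[a|b]\<close>.\<close>
  define \<tau> where "\<tau> a b = T_shuffle (s a) (s b) - T_shuffle (tp (e a b)) (s (a \<star> b)) - D (e a b)" for a b
  \<comment> \<open>The shuffle product of \<open>[1|1]\<close> with \<open>[a|b]\<close>, six terms
    with the signs of the shuffles.\<close>
  define sh where "sh a b = frag_of [?one, ?one, a, b] - frag_of [?one, a, ?one, b] + frag_of [?one, a, b, ?one]
    + frag_of [a, ?one, ?one, b] - frag_of [a, ?one, b, ?one] + frag_of [a, b, ?one, ?one]" for a b
  \<comment> \<open>The coefficient of \<open>[1|1|1|1]\<close>, whose boundary is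
    \<open>[1|1|1]\<close>, has two parts: \<open>N (e a b)\<close> matches the image of
    \<open>D\<close>, and the 1 compensates the \<open>[1|1|1]\<close> that \<open>[1|1]\<close>
    shuffled with the boundary of \<open>[1|a \<star> b]\<close> leaves behind.\<close>
  define \<kappa> where "\<kappa> a b = sh a b - sh ?one (a \<star> b) - frag_cmul (N (e a b) - 1) (frag_of [?one, ?one, ?one, ?one])" for a b
  define L where "L = frag_extend (\<lambda>xs. T_commutator (s (xs ! 0)))"
  define K where "K = frag_extend (\<lambda>xs. frag_of [?one, ?one, xs ! 0] - frag_of [?one, xs ! 0, ?one] + frag_of [xs ! 0, ?one, ?one])"
  define t where "t = frag_extend (\<lambda>xs. \<tau> (xs ! 0) (xs ! 1)) x"
  define c where "c = frag_extend (\<lambda>xs. \<kappa> (xs ! 0) (xs ! 1)) x"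
  have x': "Poly_Mapping.keys x \<subseteq> bar_tuples Q 2"
    using x(1) by (simp add: bar_chains_iff)

  have t_mem: "t \<in> bar_chains E 3"
    unfolding t_def using x(1)
    by (rule frag_extend_bar_chains)
      (auto simp: bar_tuples_2 \<tau>_def intro!: bar_chains_intros T_shuffle_chain D)
  have c_mem: "c \<in> bar_chains Q 4"
    unfolding c_def using x(1)
    by (rule frag_extend_bar_chains)
      (auto simp: bar_tuples_2 \<kappa>_def sh_def bar_tuples_list intro!: bar_chains_intros)

  have "bar_boundary E t = - L (bar_boundary Q x)"
    unfolding t_def using x'
  proof (rule frag_additive_eq)
    fix xs assume "xs \<in> bar_tuples Q 2"
    then obtain a b where m: "a \<in> carrier Q" "b \<in> carrier Q" and xs: "xs = [a, b]"
      by (auto simp: bar_tuples_2)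
    show "bar_boundary E (frag_extend (\<lambda>xs. \<tau> (xs ! 0) (xs ! 1)) (frag_of xs)) = - L (bar_boundary Q (frag_of xs))"
      using m by (simp add: xs \<tau>_def bar_boundary_simps boundary_T_shuffle D L_def bar_boundary_2
        frag_extend_diff frag_extend_add euler_eq)
  qed (auto simp: L_def frag_extend_diff bar_boundary_simps)
  then have dt: "bar_boundary E t = 0"
    by (simp add: x(2) L_def)

  have "bar_boundary Q c = bar_map p t + K (bar_boundary Q x)"
    unfolding t_def c_def using x'
  proof (rule frag_additive_eq)
    fix xs assume "xs \<in> bar_tuples Q 2"
    then obtain a b where m: "a \<in> carrier Q" "b \<in> carrier Q" and xs: "xs = [a, b]"
      by (auto simp: bar_tuples_2)
    show "bar_boundary Q (frag_extend (\<lambda>xs. \<kappa> (xs ! 0) (xs ! 1)) (frag_of xs))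
      = bar_map p (frag_extend (\<lambda>xs. \<tau> (xs ! 0) (xs ! 1)) (frag_of xs)) + K (bar_boundary Q (frag_of xs))"
      using m by (simp add: xs \<tau>_def \<kappa>_def sh_def T_shuffle_def bar_boundary_simps bar_map_simps D K_def
        bar_boundary_2 bar_boundary_4 frag_extend_diff frag_extend_add p_T frag_simps)
  qed (auto simp: K_def frag_extend_diff bar_boundary_simps bar_map_simps)
  then have dc: "bar_boundary Q c = bar_map p t"
    by (simp add: x(2) K_def)

  \<comment> \<open>Multiples of \<open>[1|1]\<close> modulo boundaries; all \<open>[1|b]\<close>
    and \<open>[b|1]\<close> belong here. By \<open>degenerate_cycle_boundary\<close> it is enough
    to bring the error into this set.\<close>
  define Dg where "Dg = {y. \<exists>n. y - frag_cmul n (frag_of [?one, ?one]) \<in> bar_boundaries Q 2}"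
  have bd: "bar_boundary Q w \<in> bar_boundaries Q 2" if "w \<in> bar_chains Q 3" for w
    using that by (simp add: bar_boundaries_def)
  have Dg_closed: "diff_closed Dg"
    unfolding diff_closed_def
  proof (intro conjI ballI)
    show "0 \<in> Dg"
      using diff_closedD(1)[OF diff_closed_bar_boundaries] by (auto simp: Dg_def intro!: exI[of _ 0])
    fix y z assume "y \<in> Dg" "z \<in> Dg"
    then obtain n m where nm: "y - frag_cmul n (frag_of [?one, ?one]) \<in> bar_boundaries Q 2"
      "z - frag_cmul m (frag_of [?one, ?one]) \<in> bar_boundaries Q 2"
      by (auto simp: Dg_def)
    have "y - z - frag_cmul (n - m) (frag_of [?one, ?one]) \<in> bar_boundaries Q 2"
      using diff_closedD(2)[OF diff_closed_bar_boundaries nm] by (simp add: frag_simps algebra_simps)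
    then show "y - z \<in> Dg" by (auto simp: Dg_def)
  qed
  have Dg_left: "frag_of [?one, b] \<in> Dg" and Dg_right: "frag_of [b, ?one] \<in> Dg" if "b \<in> carrier Q" for b
  proof -
    have "frag_of [?one, b] - frag_cmul 1 (frag_of [?one, ?one]) = bar_boundary Q (frag_of [?one, ?one, b])"
      using that by (simp add: bar_boundary_3)
    also have "\<dots> \<in> bar_boundaries Q 2"
      using that by (intro bd) (simp add: bar_tuples_list)
    finally show "frag_of [?one, b] \<in> Dg" unfolding Dg_def by blast
    have "frag_of [b, ?one] - frag_cmul 1 (frag_of [?one, ?one]) = bar_boundary Q (- frag_of [b, ?one, ?one])"
      using that by (simp add: bar_boundary_3 bar_boundary_simps)
    also have "\<dots> \<in> bar_boundaries Q 2"
      using that by (intro bd bar_chains_intros) (simp add: bar_tuples_list)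
    finally show "frag_of [b, ?one] \<in> Dg" unfolding Dg_def by blast
  qed
  have Dg_cmul: "frag_cmul n y \<in> Dg" if "y \<in> Dg" for n y
    using diff_closedD(1,2)[OF Dg_closed] that by (intro frag_closure_minus_cmul[where P = "\<lambda>y. y \<in> Dg"]) auto

  have "thom_chain E Q p T (c, t) - x \<in> Dg"
    unfolding thom_chain_def case_prod_conv c_def t_def using x' Dg_closed
  proof (rule frag_additive_in[where F = "\<lambda>x. cap_e (frag_extend (\<lambda>xs. \<kappa> (xs ! 0) (xs ! 1)) x)
      + bar_map p (cap_\<eta> (frag_extend (\<lambda>xs. \<tau> (xs ! 0) (xs ! 1)) x)) - x"])
    fix xs assume "xs \<in> bar_tuples Q 2"
    then obtain a b where m: "a \<in> carrier Q" "b \<in> carrier Q" and xs: "xs = [a, b]"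
      by (auto simp: bar_tuples_2)
    define y where "y = a \<star> b"
    define m0 where "m0 = e ?one ?one"
    have y: "y \<in> carrier Q" using m by (simp add: y_def)
    \<comment> \<open>The coefficient of \<open>[a|b]\<close> in the Thom chain is \<open>m0\<close>
      from capping with \<open>e\<close> plus \<open>1 - m0\<close> from capping with \<eta>, so it
      is 1 for every section.\<close>
    have eta_T': "\<eta> T = 1 - m0" by (simp add: eta_T eta_one m0_def)
    have e1: "e ?one u = m0" "e u ?one = m0" if "u \<in> carrier Q" for u
      using e_one[OF that] by (simp_all add: m0_def)
    have "cap_e (\<kappa> a b) + bar_map p (cap_\<eta> (\<tau> a b)) - frag_of [a, b]
      = frag_cmul (\<eta> (tp (e a b)) - 1) (frag_of [?one, y]) - frag_cmul (\<eta> (tp (e a b))) (frag_of [y, ?one])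
        + frag_cmul (e a b - m0 - (N (e a b) - 1) * m0 - N' (e a b)) (frag_of [?one, ?one])"
      using m y by (simp add: \<kappa>_def \<tau>_def sh_def T_shuffle_def cap_chain_simps bar_map_simps D(1-3)
        D(4)[unfolded One_nat_def] p_T e1 eta_T' frag_simps y_def[symmetric] algebra_simps)
    also have "\<dots> \<in> Dg"
      using y by (intro diff_closedD[OF Dg_closed] Dg_cmul Dg_left Dg_right) auto
    finally show "cap_e (frag_extend (\<lambda>xs. \<kappa> (xs ! 0) (xs ! 1)) (frag_of xs))
      + bar_map p (cap_\<eta> (frag_extend (\<lambda>xs. \<tau> (xs ! 0) (xs ! 1)) (frag_of xs))) - frag_of xs \<in> Dg"
      by (simp add: xs)
  qed (simp add: frag_extend_diff cap_chain_simps bar_map_simps)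
  moreover have "bar_boundary Q (thom_chain E Q p T (c, t) - x) = 0"
    using thom_chain_cycle[OF c_mem t_mem dc dt] x(2) by (simp add: bar_boundary_simps)
  ultimately have "thom_chain E Q p T (c, t) - x \<in> bar_boundaries Q 2"
    by (auto simp: Dg_def intro: degenerate_cycle_boundary)
  with c_mem t_mem dc dt show thesis by (rule that)
qed

text \<open>With \<open>w\<close> as the correction, \<open>k\<close> times the pullback of \<eta>
  along \<open>\<phi>\<close> is \<open>\<eta> + w\<close>, and \<open>k\<close> times the pullback
  of \<open>p^*e\<close> is \<open>p^*e - \<delta>w\<close>. Multiplying the two gives
  \<open>k^2\<close> and three correction terms.\<close>

lemma eval3_theta_root:
  assumes v: "euler_square_primitive v" and k: "k > 0"
    and \<phi>: "\<phi> \<in> hom E E" "\<phi> T [^]\<^bsub>E\<^esub> k = T"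
    and t: "t \<in> bar_chains E 3" "bar_boundary E t = 0"
    and c: "c \<in> bar_chains Q 4" "bar_boundary Q c = bar_map p t"
  shows "of_nat k ^ 2 * eval3 (theta v) (bar_map \<phi> t) = eval3 (theta v) t"
proof -
  have \<phi>_mem [simp]: "\<phi> x \<in> carrier E" if "x \<in> carrier E" for x
    using \<phi>(1) that by (auto simp: hom_def)
  have \<phi>_mult [simp]: "\<phi> (x \<cdot> y) = \<phi> x \<cdot> \<phi> y" if "x \<in> carrier E" "y \<in> carrier E" for x y
    using \<phi>(1) that by (rule hom_mult)
  have "\<phi> (tp (int k)) = T"
    using hom_int_pow[OF \<phi>(1) T_mem group_E group_E, of "int k"] \<phi>(2) T_mem by (simp add: int_pow_int)
  then have \<phi>_tp: "\<phi> (tp (int k) \<cdot> x) = T \<cdot> \<phi> x" if "x \<in> carrier E" for x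
    using that by simp
  define w where "w x = int k * \<eta> (\<phi> x) - \<eta> x" for x
  have w_tp: "w (tp (int k) \<cdot> x) = w x" if "x \<in> carrier E" for x
    using that eta_tp_mult[of "\<phi> x" 1] by (simp add: w_def \<phi>_tp eta_tp_mult algebra_simps del: \<phi>_mult)
  \<comment> \<open>The image of \<open>T^k\<close> under \<open>\<phi>\<close> is \<open>T\<close>,
    which \<open>p\<close> kills; for \<open>\<phi> T\<close> itself this may fail.\<close>
  have p_tp_mult: "p (tp (int k) \<cdot> x) = p x" "p (\<phi> (tp (int k) \<cdot> x)) = p (\<phi> x)" if "x \<in> carrier E" for x
    using that T_mem by (simp_all add: \<phi>_tp p_T del: \<phi>_mult)
  \<comment> \<open>The correction involving \<eta> times \<open>\<delta>w\<close> is not invariant.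
    The coboundary of the product \<open>g\<close> of \<eta> and \<open>w\<close> replaces it by
    \<open>p^*e\<close> times \<open>w\<close>, the last integral term of \<open>z\<close>.\<close>
  define g where "g x y = (of_int (\<eta> x * w y) :: rat)" for x y
  define z where "z x y u = of_int (w x * e (p y) (p u) + w x * (w (y \<cdot> u) - w y - w u) + e (p x) (p y) * w u)
    + of_nat k ^ 2 * v (p (\<phi> x)) (p (\<phi> y)) (p (\<phi> u)) - v (p x) (p y) (p u)" for x y u
  have z: "z x y u = of_nat k ^ 2 * theta v (\<phi> x) (\<phi> y) (\<phi> u) - theta v x y u
      - (g y u - g (x \<cdot> y) u + g x (y \<cdot> u) - g x y)"
    if m: "x \<in> carrier E" "y \<in> carrier E" "u \<in> carrier E" for x y u
  proof -
    have "int k * e (p (\<phi> y)) (p (\<phi> u)) = e (p y) (p u) + (w (y \<cdot> u) - w y - w u)"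
      using m by (simp add: w_def eta_mult algebra_simps)
    moreover have "int k * \<eta> (\<phi> x) = \<eta> x + w x"
      by (simp add: w_def)
    ultimately have "int k ^ 2 * (\<eta> (\<phi> x) * e (p (\<phi> y)) (p (\<phi> u)))
        = (\<eta> x + w x) * (e (p y) (p u) + (w (y \<cdot> u) - w y - w u))"
      by (metis (no_types, lifting) mult.assoc mult.left_commute power2_eq_square)
    from arg_cong[OF this, of "of_int :: int \<Rightarrow> rat"]
    have "of_nat k ^ 2 * (of_int (\<eta> (\<phi> x)) * of_int (e (p (\<phi> y)) (p (\<phi> u))))
        = (of_int ((\<eta> x + w x) * (e (p y) (p u) + (w (y \<cdot> u) - w y - w u))) :: rat)"
      by simp
    moreover have "g y u - g (x \<cdot> y) u = - of_int (\<eta> x * w u) - of_int (e (p x) (p y) * w u)"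
      using m by (simp add: g_def eta_mult algebra_simps)
    ultimately show ?thesis
      by (simp add: z_def theta_def distrib_left) (simp add: g_def algebra_simps)
  qed
  have "shift_invariant k z"
    unfolding shift_invariant_def
  proof (intro ballI conjI)
    fix x y u assume m: "x \<in> carrier E" "y \<in> carrier E" "u \<in> carrier E"
    note simps = w_tp p_tp_mult tp_mult_left tp_mem E.m_closed
    show "z (tp (int k) \<cdot> x) y u = z x y u" "z x (tp (int k) \<cdot> y) u = z x y u"
      "z x y (tp (int k) \<cdot> u) = z x y u"
      using m by (simp_all only: z_def simps)
  qed
  moreover have "cocycle3 z"
    unfolding cocycle3_def
  proof (intro ballI)
    fix x y u r assume m: "x \<in> carrier E" "y \<in> carrier E" "u \<in> carrier E" "r \<in> carrier E"
    have th: "theta v b c d - theta v (a \<cdot> b) c d + theta v a (b \<cdot> c) d - theta v a b (c \<cdot> d) + theta v a b c = 0"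
      if "a \<in> carrier E" "b \<in> carrier E" "c \<in> carrier E" "d \<in> carrier E" for a b c d
      using theta_cocycle[OF v] that by (simp add: cocycle3_def)
    have "of_nat k ^ 2 * (theta v (\<phi> y) (\<phi> u) (\<phi> r) - theta v (\<phi> x \<cdot> \<phi> y) (\<phi> u) (\<phi> r)
      + theta v (\<phi> x) (\<phi> y \<cdot> \<phi> u) (\<phi> r) - theta v (\<phi> x) (\<phi> y) (\<phi> u \<cdot> \<phi> r) + theta v (\<phi> x) (\<phi> y) (\<phi> u)) = 0"
      using th[of "\<phi> x" "\<phi> y" "\<phi> u" "\<phi> r"] m by simp
    with th[OF m] show "z y u r - z (x \<cdot> y) u r + z x (y \<cdot> u) r - z x y (u \<cdot> r) + z x y u = 0"
      using m by (simp add: z E.m_assoc algebra_simps)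
  qed
  ultimately have "eval3 z t = 0"
    using k t c by (intro eval3_shift_invariant)
  moreover have "eval3 (\<lambda>x y u. g y u - g (x \<cdot> y) u + g x (y \<cdot> u) - g x y) t = 0"
    using t by (rule eval3_coboundary)
  moreover have "eval3 (theta v) (bar_map \<phi> t) = eval3 (\<lambda>x y u. theta v (\<phi> x) (\<phi> y) (\<phi> u)) t"
    unfolding frag_eval_bar_map using t(1) by (rule frag_eval_3_cong) simp
  moreover have "eval3 z t = of_nat k ^ 2 * eval3 (\<lambda>x y u. theta v (\<phi> x) (\<phi> y) (\<phi> u)) t - eval3 (theta v) t
      - eval3 (\<lambda>x y u. g y u - g (x \<cdot> y) u + g x (y \<cdot> u) - g x y) t"
    unfolding frag_eval_fun_diff[symmetric] frag_eval_fun_cmul[symmetric] using t(1)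
    by (rule frag_eval_3_cong) (simp add: z numeral_2_eq_2)
  ultimately show ?thesis by simp
qed

end

section \<open>From homology and cohomology classes to representatives\<close>

context central_Z_extension
begin

abbreviation ec :: "'q list \<Rightarrow> int" where "ec \<equiv> euler_cocycle E Q p T"
abbreviation er :: "'q list \<Rightarrow> rat" where "er \<equiv> \<lambda>xs. of_int (ec xs)"

lemma ec_boundary: "w \<in> bar_boundaries Q 2 \<Longrightarrow> frag_eval ec w = 0"
proof -
  assume "w \<in> bar_boundaries Q 2"
  then obtain c where c: "c \<in> bar_chains Q 3" "w = bar_boundary Q c"
    by (auto simp: bar_boundaries_numeral)
  have "e b c - e (a \<star> b) c + e a (b \<star> c) = e a b"
    if "a \<in> carrier Q" "b \<in> carrier Q" "c \<in> carrier Q" for a b c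
    using euler_cocycle_eq[OF that] by simp
  then have "frag_eval ec (bar_boundary Q c) = frag_eval (\<lambda>_. 0) c"
    unfolding frag_eval_boundary[of _ Q c] using c(1)
    by (intro frag_eval_cong[where S = "bar_tuples Q 3"])
      (auto simp: bar_chains_iff bar_tuples_3 bar_boundary_3 frag_eval_simps)
  then show ?thesis using c by (simp add: frag_eval_def)
qed

text \<open>The pairing is constant on the product of the two cosets because coboundaries vanish on
  cycles and \<open>ec\<close> vanishes on boundaries; only then does \<open>the_elem\<close> return
  it.\<close>

lemma eval_euler_class:
  assumes x: "x \<in> bar_cycles Q 2"
  shows "eval_class (euler_class E Q p T) (coset_class (bar_boundaries Q 2) x) = frag_eval ec x"
  unfolding eval_class_def
proof (rule the_elem_image)
  show "(ec, x) \<in> euler_class E Q p T \<times> coset_class (bar_boundaries Q 2) x"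
    using diff_closedD(1)[OF diff_closed_bar_boundaries] diff_closedD(1)[OF diff_closed_bar_coboundaries]
    by (force simp: euler_class_def coset_class_eq)
  fix y assume "y \<in> euler_class E Q p T \<times> coset_class (bar_boundaries Q 2) x"
  then obtain b w where y: "y = (b + ec, w + x)" and b: "b \<in> bar_coboundaries Q 2" and w: "w \<in> bar_boundaries Q 2"
    by (auto simp: euler_class_def coset_class_eq)
  obtain \<beta> where \<beta>: "b = bar_coboundary Q 1 \<beta>"
    using b by (auto simp: bar_coboundaries_numeral)
  obtain c where c: "c \<in> bar_chains Q 3" "w = bar_boundary Q c"
    using w by (auto simp: bar_boundaries_numeral)
  have "w \<in> bar_chains Q 2"
    using bar_boundary_chains[OF Q.is_monoid, of c 2] c by (simp add: eval_nat_numeral)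
  then have "w + x \<in> bar_chains Q (Suc 1)" "bar_boundary Q (w + x) = 0"
    using x c bar_boundary_boundary_3[OF c(1)]
    by (auto simp: bar_cycles_def bar_boundary_simps numeral_2_eq_2 intro!: bar_chains_intros)
  then have "frag_eval b (w + x) = 0"
    unfolding \<beta> by (subst frag_eval_coboundary) auto
  then show "(case y of (u, c) \<Rightarrow> eval_cochain u c) = frag_eval ec x"
    by (simp add: y eval_cochain_eq_frag_eval frag_eval_fun_add frag_eval_add ec_boundary[OF w])
qed

lemma rational_euler_class:
  "rational_class Q 2 (euler_class E Q p T) = coset_class (bar_coboundaries Q 2) er"
  unfolding rational_class_def euler_class_def
proof (rule class_map_coset_class_additive)
  show "(\<lambda>u xs. of_int (u xs)) ` bar_coboundaries Q 2 \<subseteq> (bar_coboundaries Q 2 :: ('q list \<Rightarrow> rat) set)"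
  proof (clarsimp simp: bar_coboundaries_numeral simp del: One_nat_def)
    fix \<beta> :: "'q list \<Rightarrow> int" assume "\<beta> \<in> bar_cochains Q 1"
    then show "(\<lambda>xs. of_int (bar_coboundary Q 1 \<beta> xs)) \<in> bar_coboundary Q 1 ` (bar_cochains Q 1 :: ('q list \<Rightarrow> rat) set)"
      by (intro image_eqI[of _ _ "\<lambda>xs. of_int (\<beta> xs)"]) (auto simp: bar_cochains_def bar_coboundary_def fun_eq_iff)
  qed
qed (auto simp: diff_closed_bar_coboundaries diff_closedD(1)[OF diff_closed_bar_coboundaries])

text \<open>Changing the factors by \<open>\<delta>\<alpha>\<close> and
  \<open>\<delta>\<beta>\<close> changes the product by the coboundary of \<open>\<gamma>\<close>:
  \<alpha> times the second changed factor, plus \<open>er\<close> times \<beta>. Both 2-cochains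
  are cocycles, and the even degree of \<open>er\<close> avoids a sign.\<close>

lemma cup_euler_class:
  "cup_product Q 2 2 (coset_class (bar_coboundaries Q 2) er) (coset_class (bar_coboundaries Q 2) er)
    = coset_class (bar_coboundaries Q 4) (cup_cochain Q 2 2 er er)"
  unfolding cup_product_def class_map_def
proof (rule the_elem_image)
  show "(er, er) \<in> coset_class (bar_coboundaries Q 2) er \<times> coset_class (bar_coboundaries Q 2) er"
    using diff_closedD(1)[OF diff_closed_bar_coboundaries] by (force simp: coset_class_eq)
  fix y assume "y \<in> coset_class (bar_coboundaries Q 2) er \<times> coset_class (bar_coboundaries Q 2) er"
  then obtain b b' where y: "y = (b + er, b' + er)"
    and b: "b \<in> bar_coboundaries Q 2" "b' \<in> bar_coboundaries Q 2"
    by (auto simp: coset_class_eq)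
  obtain \<alpha> \<beta> where \<alpha>: "b = bar_coboundary Q 1 \<alpha>" and \<beta>: "b' = bar_coboundary Q 1 \<beta>"
    using b by (auto simp: bar_coboundaries_numeral)
  define \<gamma> where "\<gamma> = cup_cochain Q 1 2 \<alpha> (b' + er) + cup_cochain Q 2 1 er \<beta>"
  have \<gamma>: "\<gamma> [x, y, z] = \<alpha> [x] * (b' + er) [y, z] + er [x, y] * \<beta> [z]"
    if "x \<in> carrier Q" "y \<in> carrier Q" "z \<in> carrier Q" for x y z
    using that by (simp add: \<gamma>_def cup_cochain_def bar_tuples_def)
  have ere: "er [y, z] + er [x, y \<star> z] = er [x \<star> y, z] + er [x, y]"
    if "x \<in> carrier Q" "y \<in> carrier Q" "z \<in> carrier Q" for x y z
    using arg_cong[OF euler_cocycle_eq[OF that], of "of_int :: int \<Rightarrow> rat"] by simp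
  have "cup_cochain Q 2 2 (b + er) (b' + er) - cup_cochain Q 2 2 er er = bar_coboundary Q 3 \<gamma>"
  proof
    fix xs
    show "(cup_cochain Q 2 2 (b + er) (b' + er) - cup_cochain Q 2 2 er er) xs = bar_coboundary Q 3 \<gamma> xs"
    proof (cases "xs \<in> bar_tuples Q 4")
      case False
      then show ?thesis
        by (simp add: cup_cochain_def bar_coboundary_def)
    next
      case True
      then obtain a1 a2 a3 a4 where m: "a1 \<in> carrier Q" "a2 \<in> carrier Q" "a3 \<in> carrier Q" "a4 \<in> carrier Q"
        and xs: "xs = [a1, a2, a3, a4]"
        by (auto simp: bar_tuples_4)
      have "b' [a3, a4] - b' [a2 \<star> a3, a4] + b' [a2, a3 \<star> a4] - b' [a2, a3] = 0"
        using bar_coboundaries_2_cocycle[OF Q.is_monoid b(2)] m by blast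
      then have v: "b' [a3, a4] = b' [a2 \<star> a3, a4] - b' [a2, a3 \<star> a4] + b' [a2, a3]"
        by simp
      have e: "er [a3, a4] = er [a2 \<star> a3, a4] + er [a2, a3] - er [a2, a3 \<star> a4]"
        "er [a2, a3] = er [a1 \<star> a2, a3] + er [a1, a2] - er [a1, a2 \<star> a3]"
        using ere[of a2 a3 a4] ere[of a1 a2 a3] m by simp_all
      have bval: "b [a1, a2] = \<alpha> [a2] - \<alpha> [a1 \<star> a2] + \<alpha> [a1]" "b' [a3, a4] = \<beta> [a4] - \<beta> [a3 \<star> a4] + \<beta> [a3]"
        unfolding \<alpha> \<beta> using m by (intro bar_coboundary_1; simp)+
      define V where "V x y = b' [x, y] + er [x, y]" for x y
      have V: "V a3 a4 = V (a2 \<star> a3) a4 - V a2 (a3 \<star> a4) + V a2 a3"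
        using v e(1) by (simp add: V_def)
      have \<gamma>': "\<gamma> [x, y, z] = \<alpha> [x] * V y z + er [x, y] * \<beta> [z]"
        if "x \<in> carrier Q" "y \<in> carrier Q" "z \<in> carrier Q" for x y z
        using \<gamma>[OF that] by (simp add: V_def)
      \<comment> \<open>Grouped so that the inner brackets are the cocycle defects of
        \<open>V\<close> and \<open>er\<close>, which vanish.\<close>
      have "bar_coboundary Q 3 \<gamma> xs = (\<alpha> [a2] - \<alpha> [a1 \<star> a2] + \<alpha> [a1]) * V a3 a4
          - \<alpha> [a1] * (V a3 a4 - (V (a2 \<star> a3) a4 - V a2 (a3 \<star> a4) + V a2 a3))
          + (er [a2, a3] - (er [a1 \<star> a2, a3] + er [a1, a2] - er [a1, a2 \<star> a3])) * \<beta> [a4]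
          + er [a1, a2] * (\<beta> [a4] - \<beta> [a3 \<star> a4] + \<beta> [a3])"
        using m unfolding xs by (simp add: bar_coboundary_3 \<gamma>' algebra_simps)
      also have "\<dots> = b [a1, a2] * V a3 a4 + er [a1, a2] * b' [a3, a4]"
        unfolding V[symmetric] e(2)[symmetric] bval[symmetric] by simp
      also have "\<dots> = (b [a1, a2] + er [a1, a2]) * (b' [a3, a4] + er [a3, a4]) - er [a1, a2] * er [a3, a4]"
        by (simp add: V_def algebra_simps)
      finally show ?thesis
        using True by (simp add: xs cup_cochain_def)
    qed
  qed
  moreover have "\<gamma> \<in> bar_cochains Q 3"
    by (simp add: \<gamma>_def bar_cochains_def cup_cochain_def eval_nat_numeral)
  ultimately have "cup_cochain Q 2 2 (b + er) (b' + er) - cup_cochain Q 2 2 er er \<in> bar_coboundaries Q 4"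
    unfolding bar_coboundaries_numeral by blast
  then show "coset_class (bar_coboundaries Q (2 + 2)) (case y of (u, v) \<Rightarrow> cup_cochain Q 2 2 u v)
      = coset_class (bar_coboundaries Q 4) (cup_cochain Q 2 2 er er)"
    by (simp add: y coset_class_eq_iff[OF diff_closed_bar_coboundaries])
qed

lemma euler_square_zero_primitive:
  assumes "cup_product Q 2 2 (rational_class Q 2 (euler_class E Q p T)) (rational_class Q 2 (euler_class E Q p T))
    = \<one>\<^bsub>group_cohomology Q 4\<^esub>"
  obtains v where "euler_square_primitive v"
proof -
  have "coset_class (bar_coboundaries Q 4) (cup_cochain Q 2 2 er er) = bar_coboundaries Q 4"
    using assms unfolding rational_euler_class cup_euler_class
    by (simp add: group_cohomology_def one_add_group_Mod)
  also have "\<dots> = coset_class (bar_coboundaries Q 4) 0"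
    by (rule coset_class_0[symmetric])
  finally have "cup_cochain Q 2 2 er er \<in> bar_coboundaries Q 4"
    by (simp add: coset_class_eq_iff[OF diff_closed_bar_coboundaries])
  then obtain v where v: "cup_cochain Q 2 2 er er = bar_coboundary Q 3 v"
    unfolding bar_coboundaries_numeral by blast
  have "euler_square_primitive (\<lambda>a b c. v [a, b, c])"
    unfolding euler_square_primitive_def
  proof (intro ballI)
    fix a b c d assume m: "a \<in> carrier Q" "b \<in> carrier Q" "c \<in> carrier Q" "d \<in> carrier Q"
    have "cup_cochain Q 2 2 er er [a, b, c, d] = er [a, b] * er [c, d]"
      using m by (simp add: cup_cochain_def bar_tuples_def)
    then show "v [b, c, d] - v [a \<star> b, c, d] + v [a, b \<star> c, d] - v [a, b, c \<star> d] + v [a, b, c] = er [a, b] * er [c, d]"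
      using m by (simp add: v bar_coboundary_3)
  qed
  then show thesis by (rule that)
qed

lemma thom_chain_add: "thom_chain E Q p T (y + z) = thom_chain E Q p T y + thom_chain E Q p T z"
  by (cases y, cases z) (simp add: thom_chain_def cap_chain_simps bar_map_simps)

lemma cone_boundary_diff: "cone_boundary E Q p (y - z) = cone_boundary E Q p y - cone_boundary E Q p z"
  by (cases y, cases z) (simp add: cone_boundary_def bar_boundary_simps bar_map_simps)

lemma diff_closed_cone_boundaries: "diff_closed (cone_boundary E Q p ` cone_chains E Q (Suc n))"
proof (intro diff_closed_image cone_boundary_diff)
  show "diff_closed (cone_chains E Q (Suc n))"
    using diff_closedD[OF diff_closed_bar_chains[of Q "Suc n"]] diff_closedD[OF diff_closed_bar_chains[of E n]]
    by (auto simp: diff_closed_def cone_chains_def zero_prod_def)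
qed

text \<open>The term \<open>- bar_map p t\<close> in the cone boundary cancels the defect from
  capping the boundary of \<open>t\<close> with \<eta>. Hence the Thom map is defined on
  classes.\<close>

lemma thom_chain_boundary:
  assumes "z \<in> cone_chains E Q 5"
  shows "thom_chain E Q p T (cone_boundary E Q p z) \<in> bar_boundaries Q 2"
proof -
  obtain c t where z: "z = (c, t)" and c: "c \<in> bar_chains Q 5" and t: "t \<in> bar_chains E 4"
    using assms by (cases z) (auto simp: cone_chains_def)
  have "thom_chain E Q p T (cone_boundary E Q p z) = bar_boundary Q (cap_e c + bar_map p (cap_\<eta> t))"
    using cap_e_boundary_5[OF c] cap_\<eta>_boundary_4[OF t]
    by (simp add: z thom_chain_def cone_boundary_def bar_boundary_simps cap_chain_simps bar_map_simps)
  moreover have "cap_e c + bar_map p (cap_\<eta> t) \<in> bar_chains Q 3"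
    using cap_e_chains[of c 3] cap_\<eta>_chains[of t 3] c t
    by (intro bar_chains_intros bar_map_chains[OF p_funcset]) auto
  ultimately show ?thesis
    by (simp add: bar_boundaries_numeral)
qed

text \<open>\<open>inv_into\<close> yields a true preimage because \<open>thom_surj\<close> puts the
  class into the image. Which preimage is chosen stays unknown; the Thom chain of its representative
  is homologous to \<open>x\<close>, and that is all \<theta> sees.\<close>

lemma gysin_map_representative:
  assumes x: "x \<in> bar_cycles Q 2"
  obtains c t where "c \<in> bar_chains Q 4" "t \<in> bar_chains E 3" "bar_boundary Q c = bar_map p t"
    "bar_boundary E t = 0" "thom_chain E Q p T (c, t) - x \<in> bar_boundaries Q 2"
    "gysin_map E Q p T 2 (coset_class (bar_boundaries Q 2) x) = coset_class (bar_boundaries E 3) t"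
proof -
  define CB where "CB = cone_boundary E Q p ` cone_chains E Q 5"
  define CZ where "CZ = {z \<in> cone_chains E Q 4. cone_boundary E Q p z = 0}"
  let ?\<sigma> = "coset_class (bar_boundaries Q 2) x"
  have carrier: "carrier (cone_homology E Q p 4) = coset_class CB ` CZ"
    by (simp add: cone_homology_def carrier_add_group_Mod CB_def CZ_def eval_nat_numeral)
  have CB0: "0 \<in> CB"
    using diff_closedD(1)[OF diff_closed_cone_boundaries[of 4]] by (simp add: CB_def)
  have thom: "thom_map E Q p T 2 (coset_class CB z) = coset_class (bar_boundaries Q 2) (thom_chain E Q p T z)" for z
    unfolding thom_map_def
    by (rule class_map_coset_class_additive[OF diff_closed_bar_boundaries CB0 thom_chain_add])
      (auto simp: CB_def thom_chain_boundary)
  have connecting: "cone_connecting E 3 (coset_class CB z) = coset_class (bar_boundaries E 3) (snd z)" for z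
    unfolding cone_connecting_def
  proof (rule class_map_coset_class_additive[OF diff_closed_bar_boundaries CB0])
    show "snd ` CB \<subseteq> bar_boundaries E 3"
    proof clarify
      fix c t assume "(c, t) \<in> CB"
      then obtain u where "u \<in> bar_chains E 4" "t = - bar_boundary E u"
        by (auto simp: CB_def cone_chains_def cone_boundary_def)
      then show "snd (c, t) \<in> bar_boundaries E 3"
        by (auto simp: bar_boundaries_numeral bar_boundary_simps(3)[symmetric] intro!: imageI bar_chains_intros)
    qed
  qed simp
  have CZ: "(c, t) \<in> CZ \<longleftrightarrow> c \<in> bar_chains Q 4 \<and> t \<in> bar_chains E 3
      \<and> bar_boundary Q c = bar_map p t \<and> bar_boundary E t = 0" for c t
    by (auto simp: CZ_def cone_chains_def cone_boundary_def zero_prod_def)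
  obtain c0 t0 where ct0: "c0 \<in> bar_chains Q 4" "t0 \<in> bar_chains E 3" "bar_boundary Q c0 = bar_map p t0"
    "bar_boundary E t0 = 0" "thom_chain E Q p T (c0, t0) - x \<in> bar_boundaries Q 2"
    using thom_surj[of x] x by (auto simp: bar_cycles_def)
  then have "?\<sigma> = thom_map E Q p T 2 (coset_class CB (c0, t0))"
    by (simp add: thom coset_class_eq_iff[OF diff_closed_bar_boundaries, THEN iffD2])
  moreover have "(c0, t0) \<in> CZ" using ct0 by (simp add: CZ)
  ultimately have img: "?\<sigma> \<in> thom_map E Q p T 2 ` carrier (cone_homology E Q p 4)"
    by (auto simp: carrier)
  define Z where "Z = inv_into (carrier (cone_homology E Q p 4)) (thom_map E Q p T 2) ?\<sigma>"
  have "Z \<in> carrier (cone_homology E Q p 4)" "thom_map E Q p T 2 Z = ?\<sigma>"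
    unfolding Z_def using img by (rule inv_into_into, rule f_inv_into_f)
  then obtain c t where ct: "(c, t) \<in> CZ" "Z = coset_class CB (c, t)"
    by (auto simp: carrier)
  have "coset_class (bar_boundaries Q 2) (thom_chain E Q p T (c, t)) = ?\<sigma>"
    using \<open>thom_map E Q p T 2 Z = ?\<sigma>\<close> by (simp add: ct thom)
  then have "thom_chain E Q p T (c, t) - x \<in> bar_boundaries Q 2"
    by (simp add: coset_class_eq_iff[OF diff_closed_bar_boundaries])
  moreover have "gysin_map E Q p T 2 ?\<sigma> = coset_class (bar_boundaries E 3) t"
    using connecting[of "(c, t)"] by (simp add: gysin_map_def Z_def[symmetric] ct(2))
  ultimately show thesis
    using that[of c t] ct(1) by (simp add: CZ)
qed

theorem euler_square_nonzero:
  fixes k :: nat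
  assumes \<sigma>: "\<sigma> \<in> carrier (group_homology Q 2)" "eval_class (euler_class E Q p T) \<sigma> \<noteq> 0"
    and k: "k \<ge> 2" and \<phi>: "\<phi> \<in> hom E E" "\<phi> T [^]\<^bsub>E\<^esub> k = T"
    and fixed: "homology_map E 3 \<phi> (gysin_map E Q p T 2 \<sigma>) = gysin_map E Q p T 2 \<sigma>"
  shows "cup_product Q 2 2 (rational_class Q 2 (euler_class E Q p T)) (rational_class Q 2 (euler_class E Q p T))
    \<noteq> \<one>\<^bsub>group_cohomology Q 4\<^esub>"
proof
  assume "cup_product Q 2 2 (rational_class Q 2 (euler_class E Q p T)) (rational_class Q 2 (euler_class E Q p T))
    = \<one>\<^bsub>group_cohomology Q 4\<^esub>"
  then obtain v where v: "euler_square_primitive v"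
    by (rule euler_square_zero_primitive)
  obtain x where x: "x \<in> bar_cycles Q 2" "\<sigma> = coset_class (bar_boundaries Q 2) x"
    using \<sigma>(1) by (auto simp: group_homology_def carrier_add_group_Mod)
  obtain c t where c: "c \<in> bar_chains Q 4" and t: "t \<in> bar_chains E 3" "bar_boundary E t = 0"
    and ct: "bar_boundary Q c = bar_map p t" "thom_chain E Q p T (c, t) - x \<in> bar_boundaries Q 2"
    and \<mu>: "gysin_map E Q p T 2 \<sigma> = coset_class (bar_boundaries E 3) t"
    using gysin_map_representative[OF x(1)] unfolding x(2) by metis
  have "homology_map E 3 \<phi> (coset_class (bar_boundaries E 3) t) = coset_class (bar_boundaries E 3) (bar_map \<phi> t)"
    unfolding homology_map_def
  proof (rule class_map_coset_class_additive[OF diff_closed_bar_boundaries])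
    show "bar_map \<phi> ` bar_boundaries E 3 \<subseteq> bar_boundaries E 3"
    proof (clarsimp simp: bar_boundaries_numeral)
      fix u assume "u \<in> bar_chains E 4"
      moreover have "\<phi> \<in> carrier E \<rightarrow> carrier E" using \<phi>(1) by (simp add: hom_def)
      ultimately show "bar_map \<phi> (bar_boundary E u) \<in> bar_boundary E ` bar_chains E 4"
        by (auto simp: bar_map_boundary[OF \<phi>(1)] intro!: imageI bar_map_chains)
    qed
  qed (auto simp: bar_map_simps diff_closedD(1)[OF diff_closed_bar_boundaries])
  with fixed have "bar_map \<phi> t - t \<in> bar_boundaries E 3"
    by (simp add: \<mu> coset_class_eq_iff[OF diff_closed_bar_boundaries])
  then obtain u where u: "u \<in> bar_chains E 4" "bar_map \<phi> t - t = bar_boundary E u"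
    unfolding bar_boundaries_numeral by blast
  have "eval3 (theta v) (bar_map \<phi> t) - eval3 (theta v) t = 0"
    unfolding frag_eval_diff[symmetric] u(2) by (rule eval3_boundary[OF theta_cocycle[OF v] u(1)])
  moreover have "of_nat k ^ 2 * eval3 (theta v) (bar_map \<phi> t) = eval3 (theta v) t"
    using k by (intro eval3_theta_root[OF v _ \<phi> t c ct(1)]) simp
  ultimately have "(of_nat k ^ 2 - 1) * eval3 (theta v) t = 0"
    by (simp add: algebra_simps)
  \<comment> \<open>Here \<open>k \<ge> 2\<close> enters: a number equal to its own multiple by
    \<open>k^2\<close> must vanish.\<close>
  moreover have "(of_nat k :: rat) ^ 2 \<noteq> 1"
  proof -
    have "(of_nat k :: rat) \<ge> 2"
      using k by (metis of_nat_le_iff of_nat_numeral)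
    then show ?thesis by (auto simp: power2_eq_1_iff)
  qed
  ultimately have "eval3 (theta v) t = 0" by simp
  then have "frag_eval ec (thom_chain E Q p T (c, t)) = 0"
    using eval3_theta[OF v c t(1) ct(1)] by (simp add: eval_cochain_eq_frag_eval)
  then have "frag_eval ec x = 0"
    using ec_boundary[OF ct(2)] by (simp add: frag_eval_diff)
  then show False
    using \<sigma>(2) eval_euler_class[OF x(1)] x(2) by simp
qed

end

section \<open>Real analytic maps and lifts of circle diffeomorphisms\<close>

lemma fps_conv_radius_mono:
  fixes F :: "'a::{banach,real_normed_div_algebra} fps" and G :: "'b::{banach,real_normed_div_algebra} fps"
  assumes "\<And>n. norm (fps_nth G n) \<le> norm (fps_nth F n)"
  shows "fps_conv_radius F \<le> fps_conv_radius G"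
  unfolding fps_conv_radius_def conv_radius_def
proof (rule ereal_inverse_antimono)
  show "0 \<le> limsup (\<lambda>n. ereal (root n (norm (fps_nth G n))))"
    by (intro le_Limsup) (auto intro!: always_eventually simp: real_root_ge_zero)
  show "limsup (\<lambda>n. ereal (root n (norm (fps_nth G n)))) \<le> limsup (\<lambda>n. ereal (root n (norm (fps_nth F n))))"
    by (intro Limsup_mono eventually_sequentiallyI[of 1]) (simp add: assms)
qed

text \<open>The same coefficients, read as complex numbers, have the same radius of convergence, so
  the series extends to a complex disc.\<close>

lemma real_analytic_at_imp_complex:
  assumes "real_analytic_at f x"
  obtains F where "F analytic_on {complex_of_real x}"
    "\<forall>\<^sub>F t in nhds x. F (of_real t) = of_real (f t)"
proof -
  obtain P where P: "(\<lambda>h. f (x + h)) has_fps_expansion P"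
    using assms by (auto simp: real_analytic_at_def)
  define Q where "Q = Abs_fps (\<lambda>n. complex_of_real (fps_nth P n))"
  have rad: "fps_conv_radius Q = fps_conv_radius P"
    by (intro antisym fps_conv_radius_mono) (auto simp: Q_def)
  have pos: "fps_conv_radius P > 0"
    using P by (auto simp: has_fps_expansion_def)
  have "eval_fps Q has_fps_expansion Q"
    using pos rad by (simp add: has_fps_expansion_def)
  then have "eval_fps Q analytic_on {0}"
    by (rule has_fps_expansion_imp_analytic_0)
  then have an: "(eval_fps Q \<circ> (\<lambda>z. z - of_real x)) analytic_on {complex_of_real x}"
    by (intro analytic_on_compose) (auto intro!: analytic_intros)
  have ev: "eval_fps Q (of_real h) = of_real (eval_fps P h)" if "norm h < fps_conv_radius P" for h
  proof -
    have "summable (\<lambda>n. fps_nth P n * h ^ n)"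
      using that by (intro summable_fps) 
    from suminf_of_real[OF this, where 'a = complex] show ?thesis
      by (simp add: eval_fps_def Q_def)
  qed
  have "\<forall>\<^sub>F h in nhds 0. h \<in> eball (0::real) (fps_conv_radius P)"
    using pos by (intro eventually_nhds_in_open) (auto simp: zero_ereal_def)
  moreover have "\<forall>\<^sub>F h in nhds 0. eval_fps P h = f (x + h)"
    using P by (auto simp: has_fps_expansion_def)
  ultimately have "\<forall>\<^sub>F h in nhds 0. eval_fps Q (of_real h) = of_real (f (x + h))"
    by eventually_elim (use ev in auto)
  then have "\<forall>\<^sub>F t in nhds x. (eval_fps Q \<circ> (\<lambda>z. z - of_real x)) (of_real t) = of_real (f t)"
    unfolding eventually_nhds_metric
    by (auto simp: dist_norm) (metis add.commute diff_add_cancel of_real_diff)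
  with an show thesis
    by (rule that)
qed

text \<open>Taking real parts of the coefficients does not shrink the radius, and at real arguments
  the new series sums to the real part of the old one, which is \<open>f\<close>.\<close>

lemma complex_imp_real_analytic_at:
  assumes "F analytic_on {complex_of_real x}" "\<forall>\<^sub>F t in nhds x. F (of_real t) = of_real (f t)"
  shows "real_analytic_at f x"
proof -
  define Q where "Q = fps_expansion F (of_real x)"
  have "(\<lambda>h. F (of_real x + h)) has_fps_expansion Q"
    unfolding Q_def by (rule analytic_at_imp_has_fps_expansion[OF assms(1)])
  then have pos: "fps_conv_radius Q > 0" and Q: "\<forall>\<^sub>F h in nhds 0. eval_fps Q h = F (of_real x + h)"
    by (auto simp: has_fps_expansion_def)
  define P where "P = Abs_fps (\<lambda>n. Re (fps_nth Q n))"
  have rad: "fps_conv_radius Q \<le> fps_conv_radius P"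
    by (intro fps_conv_radius_mono) (auto simp: P_def abs_Re_le_cmod)
  have ev: "eval_fps P h = Re (eval_fps Q (of_real h))" if "norm h < fps_conv_radius Q" for h
  proof -
    have "summable (\<lambda>n. fps_nth Q n * of_real h ^ n)"
      using that by (intro summable_fps) simp
    then have "(\<lambda>n. fps_nth Q n * of_real h ^ n) sums eval_fps Q (of_real h)"
      unfolding eval_fps_def by (rule summable_sums)
    then have "(\<lambda>n. Re (fps_nth Q n * of_real h ^ n)) sums Re (eval_fps Q (of_real h))"
      by (rule sums_Re)
    then show ?thesis
      unfolding eval_fps_def P_def by (simp add: sums_iff flip: of_real_power)
  qed
  have "\<forall>\<^sub>F h in nhds 0. h \<in> eball (0::real) (fps_conv_radius Q)"
    using pos by (intro eventually_nhds_in_open) (auto simp: zero_ereal_def)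
  moreover have "\<forall>\<^sub>F h in nhds (0::real). eval_fps Q (of_real h) = F (of_real x + of_real h)"
    using Q unfolding eventually_nhds_metric dist_norm
    by (metis diff_zero norm_of_real of_real_diff real_norm_def)
  moreover have "\<forall>\<^sub>F h in nhds 0. F (of_real (x + h)) = of_real (f (x + h))"
    using assms(2) unfolding eventually_nhds_metric dist_norm
    by (metis add_diff_cancel_left' diff_zero)
  ultimately have "\<forall>\<^sub>F h in nhds 0. eval_fps P h = f (x + h)"
    by eventually_elim (use ev in auto)
  moreover have "fps_conv_radius P > 0"
    using pos rad by simp
  ultimately show ?thesis
    unfolding real_analytic_at_def has_fps_expansion_def by blast
qed

lemma real_analytic_at_isCont:
  assumes "real_analytic_at f x"
  shows "isCont f x"
proof -
  obtain P where "(\<lambda>h. f (x + h)) has_fps_expansion P"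
    using assms by (auto simp: real_analytic_at_def)
  then have "isCont (\<lambda>h. f (x + h)) 0"
    by (rule has_fps_expansion_imp_continuous)
  then show ?thesis
    by (simp add: isCont_iff)
qed

lemma real_analytic_at_deriv:
  assumes "real_analytic_at f x"
  shows "(f has_real_derivative deriv f x) (at x)"
proof -
  obtain P where P: "(\<lambda>h. f (x + h)) has_fps_expansion P"
    using assms by (auto simp: real_analytic_at_def)
  then have "(eval_fps P has_real_derivative eval_fps (fps_deriv P) 0) (at 0)"
    by (intro has_field_derivative_eval_fps) (auto simp: has_fps_expansion_def zero_ereal_def)
  moreover have "\<forall>\<^sub>F h in nhds 0. eval_fps P h = f (x + h)"
    using P by (auto simp: has_fps_expansion_def)
  ultimately have "((\<lambda>h. f (x + h)) has_real_derivative eval_fps (fps_deriv P) 0) (at 0)"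
    by (subst (asm) DERIV_cong_ev) auto
  then have "(f has_real_derivative eval_fps (fps_deriv P) 0) (at x)"
    using DERIV_shift[of f _ 0 x] by (simp add: add.commute)
  then show ?thesis
    using DERIV_imp_deriv by force
qed

lemma real_analytic_at_compose:
  assumes "real_analytic_at g x" "real_analytic_at f (g x)"
  shows "real_analytic_at (f \<circ> g) x"
proof -
  obtain G where G: "G analytic_on {complex_of_real x}"
    "\<forall>\<^sub>F t in nhds x. G (of_real t) = of_real (g t)"
    using assms(1) by (rule real_analytic_at_imp_complex)
  obtain F where F: "F analytic_on {complex_of_real (g x)}"
    "\<forall>\<^sub>F t in nhds (g x). F (of_real t) = of_real (f t)"
    using assms(2) by (rule real_analytic_at_imp_complex)
  have "G (of_real x) = of_real (g x)"
    using G(2) by (rule eventually_nhds_x_imp_x)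
  with F(1) G(1) have "(F \<circ> G) analytic_on {complex_of_real x}"
    by (intro analytic_on_compose) auto
  moreover have "filterlim g (nhds (g x)) (nhds x)"
    using real_analytic_at_isCont[OF assms(1)] by (simp add: isCont_def tendsto_at_iff_tendsto_nhds)
  with F(2) have "\<forall>\<^sub>F t in nhds x. F (of_real (g t)) = of_real (f (g t))"
    by (rule eventually_compose_filterlim)
  then have "\<forall>\<^sub>F t in nhds x. (F \<circ> G) (of_real t) = of_real ((f \<circ> g) t)"
    using G(2) by eventually_elim auto
  ultimately show ?thesis
    by (rule complex_imp_real_analytic_at)
qed

lemma real_analytic_at_cong:
  assumes "\<forall>\<^sub>F t in nhds x. f t = g t" "real_analytic_at g x"
  shows "real_analytic_at f x"
proof -
  obtain G where G: "G analytic_on {complex_of_real x}"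
    "\<forall>\<^sub>F t in nhds x. G (of_real t) = of_real (g t)"
    using assms(2) by (rule real_analytic_at_imp_complex)
  from G(2) assms(1) have "\<forall>\<^sub>F t in nhds x. G (of_real t) = of_real (f t)"
    by eventually_elim auto
  with G(1) show ?thesis by (rule complex_imp_real_analytic_at)
qed

lemma real_analytic_at_linear: "real_analytic_at (\<lambda>t. a * t + b) x"
  by (rule complex_imp_real_analytic_at[of "\<lambda>z. of_real a * z + of_real b"])
     (auto intro!: analytic_intros)

section \<open>Local and global lifts of circle maps\<close>

lemma abs_circle_eq_iff: "abs_circle x = abs_circle y \<longleftrightarrow> x - y \<in> \<int>"
  by (rule circle.abs_eq_iff)

lemma abs_rep_circle [simp]: "abs_circle (rep_circle z) = z"
  by (rule Quotient_abs_rep[OF Quotient_circle])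

lemma circle_surj: obtains t where "z = abs_circle t"
  by (metis abs_rep_circle)

lemma eventually_const_of_Ints:
  fixes d :: "real \<Rightarrow> real"
  assumes "isCont d x" "\<forall>\<^sub>F t in nhds x. d t \<in> \<int>"
  shows "\<forall>\<^sub>F t in nhds x. d t = d x"
proof -
  have "d x \<in> \<int>"
    using assms(2) by (rule eventually_nhds_x_imp_x)
  have "\<forall>\<^sub>F t in nhds x. dist (d t) (d x) < 1"
    using assms(1) by (intro tendstoD) (auto simp: isCont_def tendsto_at_iff_tendsto_nhds)
  with assms(2) show ?thesis
  proof eventually_elim
    case (elim t)
    with \<open>d x \<in> \<int>\<close> show ?case
      by (metis Ints_nonzero_abs_less1 Ints_diff dist_real_def eq_iff_diff_eq_0)
  qed
qed

text \<open>A continuous integer-valued function is locally constant, so its derivative vanishes on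
  the whole line.\<close>

lemma const_of_Ints:
  fixes d :: "real \<Rightarrow> real"
  assumes "continuous_on UNIV d" "\<And>t. d t \<in> \<int>"
  obtains n :: int where "\<And>t. d t = of_int n"
proof -
  have "(d has_real_derivative 0) (at x)" for x
  proof -
    have "isCont d x"
      using assms(1) by (simp add: continuous_on_eq_continuous_at)
    then have "\<forall>\<^sub>F t in nhds x. d t = d x"
      using assms(2) by (intro eventually_const_of_Ints) auto
    from DERIV_cong_ev[OF refl this refl] show ?thesis
      by simp
  qed
  then have "d t = d 0" for t
    using DERIV_isconst_all[of d] by blast
  moreover obtain n where "d 0 = of_int n"
    using assms(2) by (meson Ints_cases)
  ultimately show thesis
    using that by metis
qed

lemma lifts_differ_by_const:
  fixes f g :: "real \<Rightarrow> real"
  assumes "isCont f x" "isCont g x" "\<forall>\<^sub>F t in nhds x. abs_circle (f t) = abs_circle (g t)"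
  obtains c where "\<forall>\<^sub>F t in nhds x. f t = g t + c"
proof -
  have "\<forall>\<^sub>F t in nhds x. f t - g t = f x - g x"
    using assms by (intro eventually_const_of_Ints[where d = "\<lambda>t. f t - g t"])
      (auto simp: abs_circle_eq_iff)
  then have "\<forall>\<^sub>F t in nhds x. f t = g t + (f x - g x)"
    by eventually_elim simp
  then show thesis by (rule that)
qed

lemma real_analytic_at_add_const:
  assumes "real_analytic_at g x"
  shows "real_analytic_at (\<lambda>t. g t + c) x"
  using real_analytic_at_compose[OF assms real_analytic_at_linear[of 1 c]] by (simp add: o_def)

text \<open>Orientation is a condition on every analytic local lift; this reduces it to a single
  one.\<close>

lemma deriv_lifts_eq:
  assumes "real_analytic_at f x" "real_analytic_at g x"
    "\<forall>\<^sub>F t in nhds x. abs_circle (f t) = abs_circle (g t)"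
  shows "deriv f x = deriv g x"
proof -
  obtain c where c: "\<forall>\<^sub>F t in nhds x. f t = g t + c"
    using lifts_differ_by_const[OF real_analytic_at_isCont real_analytic_at_isCont] assms by blast
  have "((\<lambda>t. g t + c) has_real_derivative deriv g x) (at x)"
    using real_analytic_at_deriv[OF assms(2)] by (auto intro!: derivative_eq_intros)
  with c have "(f has_real_derivative deriv g x) (at x)"
    by (subst DERIV_cong_ev) auto
  then show ?thesis
    by (rule DERIV_imp_deriv)
qed

text \<open>A continuous lift differs near each point by a constant from the analytic lift that
  exists there, so it is analytic too.\<close>

lemma lift_analytic:
  assumes "circle_analytic F" "isCont f x" "local_lift F f x"
  shows "real_analytic_at f x"
proof -
  obtain g where g: "local_lift F g x" "real_analytic_at g x"
    using assms(1) by (auto simp: circle_analytic_def)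
  have "\<forall>\<^sub>F t in nhds x. abs_circle (f t) = abs_circle (g t)"
    using assms(3) g(1) unfolding local_lift_def by eventually_elim simp
  then obtain c where "\<forall>\<^sub>F t in nhds x. f t = g t + c"
    using lifts_differ_by_const[OF assms(2) real_analytic_at_isCont[OF g(2)]] by blast
  then show ?thesis
    by (rule real_analytic_at_cong) (intro real_analytic_at_add_const g)
qed

lemma exp_2pi_eq_iff:
  "exp (complex_of_real (2 * pi * x) * \<i>) = exp (complex_of_real (2 * pi * y) * \<i>) \<longleftrightarrow> x - y \<in> \<int>"
proof -
  have "exp (complex_of_real (2 * pi * x) * \<i>) = exp (complex_of_real (2 * pi * y) * \<i>)
    \<longleftrightarrow> (\<exists>n::int. 2 * pi * x = 2 * pi * y + of_int (2 * n) * pi)"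
    by (subst exp_eq) (simp add: complex_eq_iff)
  also have "\<dots> \<longleftrightarrow> (\<exists>n::int. 2 * pi * (x - y) = 2 * pi * of_int n)"
    by (auto simp: algebra_simps)
  also have "\<dots> \<longleftrightarrow> x - y \<in> \<int>"
    by (subst mult_cancel_left) (auto elim: Ints_cases)
  finally show ?thesis .
qed

text \<open>The circle is placed in the complex plane by \<open>E\<close>, where continuity is
  tested. The line is contractible, so the resulting nowhere vanishing function has a continuous
  logarithm, whose imaginary part over \<open>2 * pi\<close> is the lift.\<close>

lemma circle_analytic_lift:
  assumes "circle_analytic F"
  obtains f where "continuous_on UNIV f" "\<And>t. F (abs_circle t) = abs_circle (f t)"
proof -
  define E where "E z = exp (complex_of_real (2 * pi * rep_circle z) * \<i>)" for z
  have E: "E (abs_circle t) = exp (complex_of_real (2 * pi * t) * \<i>)" for t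
    unfolding E_def exp_2pi_eq_iff by (simp flip: abs_circle_eq_iff)
  have "isCont (\<lambda>t. E (F (abs_circle t))) x" for x
  proof -
    obtain h where h: "local_lift F h x" "real_analytic_at h x"
      using assms by (auto simp: circle_analytic_def)
    have "isCont (\<lambda>t. exp (complex_of_real (2 * pi * h t) * \<i>)) x"
      using real_analytic_at_isCont[OF h(2)] by (intro continuous_intros)
    moreover have "\<forall>\<^sub>F t in nhds x. E (F (abs_circle t)) = exp (complex_of_real (2 * pi * h t) * \<i>)"
      using h(1) unfolding local_lift_def by eventually_elim (simp add: E)
    ultimately show ?thesis
      by (subst isCont_cong)
  qed
  then have "continuous_on UNIV (\<lambda>t. E (F (abs_circle t)))"
    by (simp add: continuous_on_eq_continuous_at)
  then obtain g where g: "continuous_on UNIV g" "\<And>t. E (F (abs_circle t)) = exp (g t)"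
    by (rule continuous_logarithm_on_contractible[OF _ contractible_UNIV]) (auto simp: E_def)
  define f where "f t = Im (g t) / (2 * pi)" for t
  have "continuous_on UNIV f"
    unfolding f_def using g(1) by (intro continuous_intros) auto
  moreover have "F (abs_circle t) = abs_circle (f t)" for t
  proof -
    \<comment> \<open>Modulus 1 forces the logarithm to be purely imaginary, so \<open>f\<close>
      retains all of \<open>g\<close>.\<close>
    have "norm (exp (g t)) = 1"
      unfolding g(2)[symmetric] E_def by (simp add: norm_exp_eq_Re)
    then have "g t = complex_of_real (2 * pi * f t) * \<i>"
      by (simp add: complex_eq_iff norm_exp_eq_Re f_def)
    then have "exp (complex_of_real (2 * pi * rep_circle (F (abs_circle t))) * \<i>)
      = exp (complex_of_real (2 * pi * f t) * \<i>)"
      using g(2)[of t] unfolding E_def by metis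
    then show ?thesis
      unfolding exp_2pi_eq_iff by (simp flip: abs_circle_eq_iff)
  qed
  ultimately show thesis by (rule that)
qed

section \<open>The covering group and its projection to the circle group\<close>

lemma diff_circle_coverD:
  assumes "f \<in> carrier diff_circle_cover"
  shows "bij f" "\<And>x. real_analytic_at f x" "\<And>x. real_analytic_at (inv_into UNIV f) x"
    "\<And>x. 0 < deriv f x" "\<And>x. f (x + 1) = f x + 1"
  using assms by (auto simp: diff_circle_cover_def diff_line_def unit_translation_def fun_eq_iff)

lemma diff_circle_coverI:
  assumes "bij f" "\<And>x. real_analytic_at f x" "\<And>x. real_analytic_at (inv_into UNIV f) x"
    "\<And>x. 0 < deriv f x" "\<And>x. f (x + 1) = f x + 1"
  shows "f \<in> carrier diff_circle_cover"
  using assms by (auto simp: diff_circle_cover_def diff_line_def unit_translation_def fun_eq_iff)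

lemma diff_circle_cover_of_int:
  assumes "f \<in> carrier diff_circle_cover"
  shows "f (x + of_int n) = f x + of_int n"
proof -
  have nat: "f (y + real m) = f y + real m" for y m
  proof (induction m)
    case (Suc m)
    then show ?case using diff_circle_coverD(5)[OF assms, of "y + real m"] by (simp add: add_ac)
  qed simp
  show ?thesis
    using nat[of x "nat n"] nat[of "x + of_int n" "nat (- n)"] by (cases "n \<ge> 0") auto
qed

lemma cover_proj_abs:
  assumes "f \<in> carrier diff_circle_cover"
  shows "cover_proj f (abs_circle t) = abs_circle (f t)"
proof -
  have "rep_circle (abs_circle t) - t \<in> \<int>"
    by (simp flip: abs_circle_eq_iff)
  then obtain n where "rep_circle (abs_circle t) = t + of_int n"
    by (metis Ints_cases add.commute diff_add_cancel)
  then show ?thesis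
    by (simp add: cover_proj_def diff_circle_cover_of_int[OF assms] abs_circle_eq_iff)
qed

lemma deriv_compose_real_analytic:
  assumes "real_analytic_at g x" "real_analytic_at f (g x)"
  shows "deriv (f \<circ> g) x = deriv f (g x) * deriv g x"
  by (rule DERIV_imp_deriv) (intro DERIV_chain real_analytic_at_deriv assms)

lemma diff_circle_cover_comp:
  assumes "f \<in> carrier diff_circle_cover" "g \<in> carrier diff_circle_cover"
  shows "f \<circ> g \<in> carrier diff_circle_cover"
proof (rule diff_circle_coverI)
  note f = diff_circle_coverD[OF assms(1)] and g = diff_circle_coverD[OF assms(2)]
  show "bij (f \<circ> g)" using f g by (intro bij_comp)
  show "real_analytic_at (f \<circ> g) x" for x
    using f g by (intro real_analytic_at_compose)
  show "real_analytic_at (inv_into UNIV (f \<circ> g)) x" for x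
    using f g by (subst o_inv_distrib) (auto intro!: real_analytic_at_compose)
  show "0 < deriv (f \<circ> g) x" for x
    using f g by (subst deriv_compose_real_analytic) auto
  show "(f \<circ> g) (x + 1) = (f \<circ> g) x + 1" for x
    using f g by simp
qed

lemma diff_circle_cover_inv:
  assumes "f \<in> carrier diff_circle_cover"
  shows "inv_into UNIV f \<in> carrier diff_circle_cover"
proof (rule diff_circle_coverI)
  note f = diff_circle_coverD[OF assms]
  let ?g = "inv_into UNIV f"
  have gf: "?g (f x) = x" and fg: "f (?g x) = x" for x
    using f(1) by (auto simp: bij_def surj_f_inv_f)
  show "bij ?g" using f(1) by (rule bij_imp_bij_inv)
  show "real_analytic_at ?g x" for x using f by simp
  show "real_analytic_at (inv_into UNIV ?g) x" for x
    using f by (simp add: inv_inv_eq)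
  have "deriv f (?g x) * deriv ?g x = 1" for x
  proof -
    have "deriv (f \<circ> ?g) x = deriv f (?g x) * deriv ?g x"
      using f by (intro deriv_compose_real_analytic) auto
    moreover have "f \<circ> ?g = (\<lambda>x. x)" using fg by auto
    ultimately show ?thesis by simp
  qed
  then show "0 < deriv ?g x" for x
    using f(4)[of "?g x"] by (metis zero_less_mult_pos zero_less_one)
  show "?g (x + 1) = ?g x + 1" for x
    using gf[of "?g x + 1"] fg f(5)[of "?g x"] by simp
qed

lemma translation_mem: "(\<lambda>x. x + of_int n) \<in> carrier diff_circle_cover"
proof (rule diff_circle_coverI)
  have inv: "inv_into UNIV (\<lambda>x. x + of_int n) = (\<lambda>x::real. 1 * x + (- of_int n))"
    by (rule inv_unique_comp) (auto simp: fun_eq_iff)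
  show "bij (\<lambda>x::real. x + of_int n)"
    by (rule o_bij[of "\<lambda>x. x - of_int n"]) auto
  show "real_analytic_at (\<lambda>x. x + of_int n) x" for x
    using real_analytic_at_linear[of 1 "of_int n"] by simp
  show "real_analytic_at (inv_into UNIV (\<lambda>x. x + of_int n)) x" for x
    unfolding inv by (rule real_analytic_at_linear)
  show "0 < deriv (\<lambda>x::real. x + of_int n) x" for x
    by (subst DERIV_imp_deriv[of _ 1]) (auto intro!: derivative_eq_intros)
qed auto

lemma diff_circle_cover_simps:
  "f \<otimes>\<^bsub>diff_circle_cover\<^esub> g = f \<circ> g" "\<one>\<^bsub>diff_circle_cover\<^esub> = id"
  "f' \<otimes>\<^bsub>diff_circle\<^esub> g' = f' \<circ> g'" "\<one>\<^bsub>diff_circle\<^esub> = id"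
  by (simp_all add: diff_circle_cover_def diff_circle_def)

lemma group_diff_circle_cover: "group diff_circle_cover"
proof (rule groupI; unfold diff_circle_cover_simps)
  show "id \<in> carrier diff_circle_cover"
    using translation_mem[of 0] by (simp add: id_def)
  show "\<exists>g\<in>carrier diff_circle_cover. g \<circ> f = id" if "f \<in> carrier diff_circle_cover" for f
    using diff_circle_cover_inv[OF that] diff_circle_coverD(1)[OF that]
    by (intro bexI[of _ "inv_into UNIV f"]) (auto simp: bij_is_inj)
qed (auto intro: diff_circle_cover_comp)

lemma int_pow_unit_translation:
  "unit_translation [^]\<^bsub>diff_circle_cover\<^esub> (n::int) = (\<lambda>x. x + of_int n)"
proof -
  interpret group diff_circle_cover by (rule group_diff_circle_cover)
  have nat: "unit_translation [^]\<^bsub>diff_circle_cover\<^esub> m = (\<lambda>x. x + real m)" for m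
    by (induction m) (auto simp: diff_circle_cover_simps unit_translation_def fun_eq_iff)
  show ?thesis
  proof (cases "n \<ge> 0")
    case True
    then obtain m where "n = int m" by (metis nonneg_int_cases)
    then show ?thesis by (simp add: int_pow_int nat)
  next
    case False
    then obtain m where m: "n = - int m" by (metis linear nonpos_int_cases)
    have "inv\<^bsub>diff_circle_cover\<^esub> (\<lambda>x. x + real m) = (\<lambda>x. x - real m)"
      using translation_mem[of "int m"] translation_mem[of "- int m"]
      by (intro inv_equality) (auto simp: diff_circle_cover_simps fun_eq_iff)
    moreover have "unit_translation \<in> carrier diff_circle_cover"
      using translation_mem[of 1] by (simp add: unit_translation_def[abs_def])
    ultimately show ?thesis
      by (simp add: m int_pow_neg int_pow_int nat)
  qed
qed

lemma cover_proj_mult: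
  assumes "f \<in> carrier diff_circle_cover" "g \<in> carrier diff_circle_cover"
  shows "cover_proj (f \<circ> g) = cover_proj f \<circ> cover_proj g"
proof
  fix z
  obtain t where "z = abs_circle t" by (rule circle_surj)
  then show "cover_proj (f \<circ> g) z = (cover_proj f \<circ> cover_proj g) z"
    using assms by (simp add: cover_proj_abs diff_circle_cover_comp)
qed

lemma cover_proj_id: "cover_proj id = id"
  by (simp add: cover_proj_def fun_eq_iff)

lemma cover_proj_mem:
  assumes f: "f \<in> carrier diff_circle_cover"
  shows "cover_proj f \<in> carrier diff_circle"
proof -
  let ?g = "inv_into UNIV f"
  note g = diff_circle_cover_inv[OF f]
  have an: "circle_analytic (cover_proj h)" if "h \<in> carrier diff_circle_cover" for h
    unfolding circle_analytic_def local_lift_def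
    using that by (intro allI exI[of _ h]) (simp add: cover_proj_abs diff_circle_coverD)
  have "?g \<circ> f = id" "f \<circ> ?g = id"
    using diff_circle_coverD(1)[OF f] by (auto simp: bij_def surj_iff)
  then have comps: "cover_proj ?g \<circ> cover_proj f = id" "cover_proj f \<circ> cover_proj ?g = id"
    using cover_proj_mult[OF f g] cover_proj_mult[OF g f] by (simp_all add: cover_proj_id)
  then have "bij (cover_proj f)"
    by (rule o_bij)
  moreover have "inv_into UNIV (cover_proj f) = cover_proj ?g"
    using comps(2,1) by (rule inv_unique_comp)
  moreover have "circle_orientation_preserving (cover_proj f)"
    unfolding circle_orientation_preserving_def
  proof (intro allI impI; elim conjE)
    fix x h
    assume h: "local_lift (cover_proj f) h x" "real_analytic_at h x"
    have "\<forall>\<^sub>F t in nhds x. abs_circle (h t) = abs_circle (f t)"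
      using h(1) unfolding local_lift_def by eventually_elim (simp add: cover_proj_abs f)
    from deriv_lifts_eq[OF h(2) diff_circle_coverD(2)[OF f] this]
    show "0 < deriv h x" using diff_circle_coverD(4)[OF f] by simp
  qed
  ultimately show ?thesis
    using an f g by (simp add: diff_circle_def)
qed

text \<open>A continuous lift exists and is analytic and increasing. What remains is that its degree
  is 1, that it is onto, and that its inverse is analytic.\<close>

lemma cover_proj_surj:
  assumes "F \<in> carrier diff_circle"
  obtains f where "f \<in> carrier diff_circle_cover" "cover_proj f = F"
proof -
  have F: "bij F" "circle_analytic F" "circle_analytic (inv_into UNIV F)" "circle_orientation_preserving F"
    using assms by (auto simp: diff_circle_def)
  obtain f where f: "continuous_on UNIV f" "\<And>t. F (abs_circle t) = abs_circle (f t)"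
    using circle_analytic_lift[OF F(2)] by blast
  have cont: "isCont f x" for x
    using f(1) by (simp add: continuous_on_eq_continuous_at)
  have lift: "local_lift F f x" for x
    by (simp add: local_lift_def f(2))
  have an: "real_analytic_at f x" for x
    using lift_analytic[OF F(2) cont lift] .
  have pos: "0 < deriv f x" for x
    using F(4) lift an by (auto simp: circle_orientation_preserving_def)
  have mono: "f x < f y" if "x < y" for x y
    using that real_analytic_at_deriv[OF an] pos by (blast intro: DERIV_pos_imp_increasing)
  have "f (t + 1) - f t \<in> \<int>" for t
  proof -
    have "abs_circle (t + 1) = abs_circle t" by (simp add: abs_circle_eq_iff)
    then have "abs_circle (f (t + 1)) = abs_circle (f t)" by (metis f(2))
    then show ?thesis by (simp add: abs_circle_eq_iff)
  qed
  moreover have "continuous_on UNIV (\<lambda>t. f (t + 1) - f t)"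
    by (intro continuous_intros continuous_on_compose2[OF f(1)]) auto
  ultimately obtain n where n: "\<And>t. f (t + 1) - f t = of_int n"
    using const_of_Ints[of "\<lambda>t. f (t + 1) - f t"] by blast
  \<comment> \<open>If the degree exceeded 1, \<open>f\<close> would attain \<open>f 0 + 1\<close>
    strictly between 0 and 1, and \<open>F\<close> would take the same value at two distinct
    points.\<close>
  have "n = 1"
  proof (rule ccontr)
    assume "n \<noteq> 1"
    moreover have "n > 0" using n[of 0] mono[of 0 1] by simp
    ultimately have "n \<ge> 2" by simp
    then have "f 0 \<le> f 0 + 1" "f 0 + 1 \<le> f 1" using n[of 0] by simp_all
    then obtain t where t: "0 \<le> t" "t \<le> 1" "f t = f 0 + 1"
      using IVT'[of f 0 "f 0 + 1" 1] continuous_on_subset[OF f(1)] by auto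
    then have "F (abs_circle t) = F (abs_circle 0)"
      by (simp add: f(2) abs_circle_eq_iff)
    then have "t \<in> \<int>"
      using F(1) by (simp add: bij_def inj_eq abs_circle_eq_iff)
    moreover have "t \<noteq> 0" using t by auto
    moreover have "t \<noteq> 1" using t n[of 0] \<open>n \<ge> 2\<close> by auto
    ultimately show False
      using t Ints_nonzero_abs_less1[of t] by auto
  qed
  then have per: "f (t + 1) = f t + 1" for t
    using n[of t] by simp
  have nat: "f (t + real m) = f t + real m" for t m
  proof (induction m)
    case (Suc m)
    then show ?case using per[of "t + real m"] by (simp add: add_ac)
  qed simp
  have "\<exists>x. f x = y" for y
  proof -
    obtain m where m: "\<bar>y - f 0\<bar> \<le> real m" using real_arch_simple by blast
    have "f (- real m) \<le> y" "y \<le> f (real m)"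
      using nat[of "- real m" m] nat[of 0 m] m by auto
    then show ?thesis
      using IVT'[of f "- real m" y "real m"] continuous_on_subset[OF f(1)] by auto
  qed
  moreover have "inj f"
    by (rule linorder_injI) (use mono in fastforce)
  ultimately have bij: "bij f"
    by (metis bij_def surj_def)
  let ?g = "inv_into UNIV f"
  have gf: "?g (f x) = x" and fg: "f (?g x) = x" for x
    using bij by (auto simp: bij_def surj_f_inv_f)
  \<comment> \<open>Continuity is enough: the inverse of \<open>f\<close> lifts the inverse of
    \<open>F\<close>, so \<open>lift_analytic\<close> gives its analyticity.\<close>
  have "isCont ?g y" for y
    using isCont_inverse_function2[of "?g y - 1" "?g y" "?g y + 1" ?g f] gf cont fg[of y] by simp
  moreover have "inv_into UNIV F (abs_circle y) = abs_circle (?g y)" for y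
    using F(1) f(2)[of "?g y"] fg by (metis bij_inv_eq_iff)
  ultimately have "real_analytic_at ?g y" for y
    using lift_analytic[OF F(3)] by (simp add: local_lift_def)
  then have mem: "f \<in> carrier diff_circle_cover"
    using bij an pos per by (intro diff_circle_coverI)
  moreover have "cover_proj f = F"
  proof
    fix z
    obtain t where "z = abs_circle t" by (rule circle_surj)
    then show "cover_proj f z = F z"
      using mem f(2) by (simp add: cover_proj_abs)
  qed
  ultimately show thesis by (rule that)
qed

lemma cover_proj_hom: "cover_proj \<in> hom diff_circle_cover diff_circle"
  by (auto simp: hom_def diff_circle_cover_simps cover_proj_mult cover_proj_mem)

lemma cover_proj_image: "cover_proj ` carrier diff_circle_cover = carrier diff_circle"
  by (auto simp: cover_proj_mem) (metis cover_proj_surj imageI)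

text \<open>Closure and inverses are inherited from the covering group along the surjection
  \<open>cover_proj\<close>.\<close>

lemma group_diff_circle: "group diff_circle"
proof (rule groupI; unfold diff_circle_cover_simps)
  fix F G H
  assume FG: "F \<in> carrier diff_circle" "G \<in> carrier diff_circle"
  then show "F \<circ> G \<in> carrier diff_circle"
    by (metis cover_proj_mult cover_proj_mem cover_proj_surj diff_circle_cover_comp)
  show "F \<circ> G \<circ> H = F \<circ> (G \<circ> H)" by (rule comp_assoc)
next
  show "id \<in> carrier diff_circle"
    using cover_proj_mem[OF translation_mem[of 0]] by (simp add: cover_proj_id flip: id_def)
next
  fix F assume "F \<in> carrier diff_circle"
  then obtain f where f: "f \<in> carrier diff_circle_cover" "F = cover_proj f"
    by (metis cover_proj_surj)
  have "cover_proj (inv_into UNIV f) \<circ> F = id"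
    using f cover_proj_mult[OF diff_circle_cover_inv[OF f(1)] f(1)] diff_circle_coverD(1)[OF f(1)]
    by (simp add: bij_is_inj cover_proj_id)
  then show "\<exists>G\<in>carrier diff_circle. G \<circ> F = id"
    using cover_proj_mem[OF diff_circle_cover_inv[OF f(1)]] by blast
qed auto

text \<open>The displacement \<open>f t - t\<close> is continuous and integer-valued.\<close>

lemma cover_proj_kernel:
  assumes f: "f \<in> carrier diff_circle_cover" and "cover_proj f = id"
  obtains n :: int where "f = (\<lambda>x. x + of_int n)"
proof -
  have "f t - t \<in> \<int>" for t
    using cover_proj_abs[OF f, of t] assms(2) by (metis abs_circle_eq_iff id_apply)
  moreover have "continuous_on UNIV (\<lambda>t. f t - t)"
    using real_analytic_at_isCont[OF diff_circle_coverD(2)[OF f]]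
    by (intro continuous_intros) (simp add: continuous_on_eq_continuous_at)
  ultimately obtain n where "\<And>t. f t - t = of_int n"
    using const_of_Ints[of "\<lambda>t. f t - t"] by blast
  then have "f = (\<lambda>x. x + of_int n)"
    by (metis add.commute diff_add_cancel)
  then show thesis by (rule that)
qed

text \<open>\<open>dilation_endo k\<close> conjugates by multiplication with \<open>k\<close>, so
  the inverse of the image is the image of the inverse.\<close>

lemma dilation_endo_mem:
  assumes f: "f \<in> carrier diff_circle_cover" and k: "k > 0"
  shows "dilation_endo k f \<in> carrier diff_circle_cover"
proof (rule diff_circle_coverI)
  note D = diff_circle_coverD[OF f]
  have lin: "real_analytic_at (\<lambda>x. a * x) y" for a y
    using real_analytic_at_linear[of a 0] by simp
  have eq: "dilation_endo k h = (\<lambda>x. 1 / real k * x) \<circ> (h \<circ> (\<lambda>x. real k * x))" for h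
    by (auto simp: dilation_endo_def)
  have an: "real_analytic_at (dilation_endo k h) x" if "\<And>x. real_analytic_at h x" for h x
    unfolding eq using that lin by (intro real_analytic_at_compose)
  have gf: "inv_into UNIV f (f x) = x" and fg: "f (inv_into UNIV f x) = x" for x
    using D(1) by (auto simp: bij_def surj_f_inv_f)
  have comps: "dilation_endo k f \<circ> dilation_endo k (inv_into UNIV f) = id"
    "dilation_endo k (inv_into UNIV f) \<circ> dilation_endo k f = id"
    using k by (auto simp: dilation_endo_def fun_eq_iff gf fg)
  show "bij (dilation_endo k f)"
    using comps(2,1) by (rule o_bij)
  show "real_analytic_at (dilation_endo k f) x" for x
    using D by (intro an)
  show "real_analytic_at (inv_into UNIV (dilation_endo k f)) x" for x
    unfolding inv_unique_comp[OF comps] using D by (intro an)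
  show "0 < deriv (dilation_endo k f) x" for x
  proof -
    have "(dilation_endo k f has_real_derivative 1 / real k * (deriv f (real k * x) * real k)) (at x)"
      unfolding dilation_endo_def
      by (intro DERIV_cmult DERIV_chain2[of f] real_analytic_at_deriv D)
         (auto intro!: derivative_eq_intros)
    then show ?thesis
      using D(4) k by (simp add: DERIV_imp_deriv)
  qed
  \<comment> \<open>Moving \<open>x\<close> by 1 moves \<open>real k * x\<close> by
    \<open>k\<close>, so commutation of \<open>f\<close> with translation by \<open>k\<close> is
    what is used.\<close>
  show "dilation_endo k f (x + 1) = dilation_endo k f x + 1" for x
    using diff_circle_cover_of_int[OF f, of "real k * x" "int k"] k
    by (simp add: dilation_endo_def algebra_simps) (simp add: field_simps)
qed

lemma dilation_endo_hom:
  assumes "k > 0"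
  shows "dilation_endo k \<in> hom diff_circle_cover diff_circle_cover"
  using assms by (auto simp: hom_def diff_circle_cover_simps dilation_endo_mem)
    (auto simp: dilation_endo_def fun_eq_iff)

text \<open>The image of \<open>unit_translation\<close> is translation by
  \<open>1 / real k\<close>, a \<open>k\<close>-th root of \<open>unit_translation\<close>.\<close>

lemma dilation_endo_translation:
  assumes "k > 0"
  shows "dilation_endo k unit_translation [^]\<^bsub>diff_circle_cover\<^esub> k = unit_translation"
proof -
  have "dilation_endo k unit_translation [^]\<^bsub>diff_circle_cover\<^esub> m = (\<lambda>x. x + real m / real k)" for m
    by (induction m)
      (use assms in \<open>auto simp: diff_circle_cover_simps dilation_endo_def unit_translation_def fun_eq_iff field_simps\<close>)
  then show ?thesis
    using assms by (simp add: unit_translation_def fun_eq_iff)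
qed

lemma central_Z_extension_diff_circle:
  "central_Z_extension diff_circle_cover diff_circle cover_proj unit_translation"
proof (rule central_Z_extension.intro)
  show "group diff_circle_cover" "group diff_circle"
    by (rule group_diff_circle_cover group_diff_circle)+
  show "cover_proj \<in> hom diff_circle_cover diff_circle"
    by (rule cover_proj_hom)
  show "cover_proj ` carrier diff_circle_cover = carrier diff_circle"
    by (rule cover_proj_image)
  have T: "unit_translation = (\<lambda>x. x + of_int 1)"
    by (simp add: unit_translation_def fun_eq_iff)
  show T_mem: "unit_translation \<in> carrier diff_circle_cover"
    unfolding T by (rule translation_mem)
  show "cover_proj unit_translation = \<one>\<^bsub>diff_circle\<^esub>"
  proof
    fix z
    obtain t where "z = abs_circle t" by (rule circle_surj)
    then show "cover_proj unit_translation z = \<one>\<^bsub>diff_circle\<^esub> z"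
      by (simp add: cover_proj_abs[OF T_mem] diff_circle_cover_simps unit_translation_def abs_circle_eq_iff)
  qed
  show "unit_translation \<otimes>\<^bsub>diff_circle_cover\<^esub> f = f \<otimes>\<^bsub>diff_circle_cover\<^esub> unit_translation"
    if "f \<in> carrier diff_circle_cover" for f
    using diff_circle_coverD(5)[OF that] by (simp add: diff_circle_cover_simps unit_translation_def fun_eq_iff)
  show "\<exists>n::int. f = unit_translation [^]\<^bsub>diff_circle_cover\<^esub> n"
    if "f \<in> carrier diff_circle_cover" "cover_proj f = \<one>\<^bsub>diff_circle\<^esub>" for f
    using cover_proj_kernel[OF that(1)] that(2) by (auto simp: int_pow_unit_translation diff_circle_cover_simps)
  show "m = n" if "unit_translation [^]\<^bsub>diff_circle_cover\<^esub> (m::int) = unit_translation [^]\<^bsub>diff_circle_cover\<^esub> (n::int)" for m n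
    using that by (simp add: int_pow_unit_translation fun_eq_iff)
qed

theorem proposition1p6:
  assumes "\<exists>\<sigma> \<in> carrier (group_homology diff_circle 2). \<exists>k::nat. k \<ge> 2
      \<and> eval_class diff_euler_class \<sigma> \<noteq> 0
      \<and> homology_map diff_circle_cover 3 (dilation_endo k) (diff_gysin_map 2 \<sigma>)
          = diff_gysin_map 2 \<sigma>"
  shows "cup_product diff_circle 2 2
           (rational_class diff_circle 2 diff_euler_class)
           (rational_class diff_circle 2 diff_euler_class)
         \<noteq> \<one>\<^bsub>group_cohomology diff_circle 4\<^esub>"
proof -
  obtain \<sigma> and k :: nat where \<sigma>: "\<sigma> \<in> carrier (group_homology diff_circle 2)" and k: "k \<ge> 2"
    and \<chi>: "eval_class diff_euler_class \<sigma> \<noteq> 0"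
    and fixed: "homology_map diff_circle_cover 3 (dilation_endo k) (diff_gysin_map 2 \<sigma>) = diff_gysin_map 2 \<sigma>"
    using assms by blast
  have "k > 0" using k by simp
  then show ?thesis
    using central_Z_extension.euler_square_nonzero[OF central_Z_extension_diff_circle \<sigma> _ k
      dilation_endo_hom dilation_endo_translation] \<chi> fixed
    by (simp add: diff_euler_class_def diff_gysin_map_def)
qed

end
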